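(* Uniformly in $(\mu,p)\in(0,1]^2$ and in $G=(V,E)$, for all $k\in\mathbb N$, $$\frac1k\, t_{\mathrm{mix}}^{\mathrm{full},(\mu,p),(\infty)}\left(\frac{1}{|V|^{k}}\right)\lesssim \frac{1}{\mu p}\,t_{\mathrm{rel}}^{\mathrm{SRW}}\log|V|+\frac1\mu|\log(1-p)|\asymp \frac{1}{\mu p}\,t_{\mathrm{mix}}^{\mathrm{SRW}}\left(\frac{1}{|V|}\right)+\frac1\mu|\log(1-p)|.$$ That is, there exists a universal constant $C\ge1$ such that for every finite connected simple graph $G=(V,E)$ with $|V|\ge2$, every $(\mu,p)\in(0,1]^2$ and every integer $k\ge1$, writing $$A=\frac{1}{\mu p}\,t_{\mathrm{rel}}^{\mathrm{SRW}}\log|V|+\frac1\mu|\log(1-p)|,\qquad D=\frac{1}{\mu p}\,t_{\mathrm{mix}}^{\mathrm{SRW}}\left(\frac{1}{|V|}\right)+\frac1\mu|\log(1-p)|,$$ one has $$\frac1k\, t_{\mathrm{mix}}^{\mathrm{full},(\mu,p),(\infty)}\left(|V|^{-k}\right)\le C\,A\qquad\text{and}\qquad \frac1C\,D\le A\le C\,D.$$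
   Context: Full process (random walk on dynamical percolation) on $G=(V,E)$ with parameters $(\mu,p)$: the continuous-time Markov chain $(X_t,\eta_t)_{t\ge0}$ on $V\times\{0,1\}^E$ (1 = open, 0 = closed) in which each edge independently refreshes at rate $\mu$, becoming open with probability $p$ and closed with probability $1-p$ independently of everything else; and at rate $1$ the walk $X$ chooses a uniformly random neighbour (in $G$) of its current location and jumps to it if and only if the connecting edge is currently open (otherwise it stays put). Its stationary distribution is $\pi_{\mathrm{full},p}=\pi\times\pi_p$, where $\pi(x)=\deg(x)/(2|E|)$ and $\pi_p$ is the product Bernoulli($p$) measure on $\{0,1\}^E$. $t_{\mathrm{mix}}^{\mathrm{full},(\mu,p),(\infty)}(\varepsilon)$ is the $L_\infty$ mixing time of the full process: the smallest $t\ge0$ such that for all states $z,w$ of the full process, $|\mathbb P_z((X_t,\eta_t)=w)/\pi_{\mathrm{full},p}(w)-1|\le\varepsilon$. (When $p=1$, $|\log(1-p)|$ is read as $+\infty$.) SRW is the continuous-time simple random walk on the static graph $G$ (all edges of $E$ present), with jump rate $1$ and transition matrix $P(x,y)=\mathbf 1\{\{x,y\}\in E\}/\deg(x)$. $t_{\mathrm{rel}}^{\mathrm{SRW}}$ is its relaxation time, the inverse of the smallest positive eigenvalue of $I-P$. $t_{\mathrm{mix}}^{\mathrm{SRW}}(\varepsilon)$ is its total variation mixing time: the smallest $t\ge0$ such that from every starting vertex the law at time $t$ is within total variation distance $\varepsilon$ of $\pi$, where $\|a\|_{\mathrm{TV}}=\frac12\sum_z|a(z)|$. Here $f\lesssim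 g$ means that $f\le c\,g$ for some constant $c>0$, and $f\asymp g$ means that both $f\lesssim g$ and $g\lesssim f$; the constants are universal.
   Formalization: The bound A ≤ C·D is claimed only for |V| ≥ 3: for |V| = 2 the SRW mixing time at 1/|V| is 0, so A/D is unbounded as p → 0; the other inequalities keep |V| ≥ 2. Vertices are natural numbers, which covers every finite graph up to isomorphism. *)

theory Defs
  imports Complex_Main "HOL-Library.Extended_Real"
begin

section \<open>Finite connected simple graphs\<close>

definition simple_graph :: "'a set \<Rightarrow> 'a set set \<Rightarrow> bool" where
  "simple_graph V E \<longleftrightarrow>
     finite V \<and> E \<subseteq> {{x, y} | x y. x \<in> V \<and> y \<in> V \<and> x \<noteq> y}"

definition connected_graph :: "'a set \<Rightarrow> 'a set set \<Rightarrow> bool" where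
  "connected_graph V E \<longleftrightarrow> (\<forall>x\<in>V. \<forall>y\<in>V. (x, y) \<in> {(u, v). {u, v} \<in> E}\<^sup>*)"

definition nbrs :: "'a set \<Rightarrow> 'a set set \<Rightarrow> 'a \<Rightarrow> 'a set" where
  "nbrs V E x = {y \<in> V. {x, y} \<in> E}"

definition deg :: "'a set \<Rightarrow> 'a set set \<Rightarrow> 'a \<Rightarrow> nat" where
  "deg V E x = card (nbrs V E x)"

section \<open>Continuous-time Markov chains on a finite state space\<close>

text \<open>
  The chain on the finite set S that jumps from x to y at rate q x y. The
  diagonal rates cancel in the generator, so q may contain jumps that
  leave the state unchanged.
\<close>

definition ctmc_generator :: "'s set \<Rightarrow> ('s \<Rightarrow> 's \<Rightarrow> real) \<Rightarrow> 's \<Rightarrow> 's \<Rightarrow> real" where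
  "ctmc_generator S q x y = q x y - (if x = y then \<Sum>z\<in>S. q x z else 0)"

primrec matrix_power :: "'s set \<Rightarrow> ('s \<Rightarrow> 's \<Rightarrow> real) \<Rightarrow> nat \<Rightarrow> 's \<Rightarrow> 's \<Rightarrow> real" where
  "matrix_power S M 0 = (\<lambda>x y. of_bool (x = y))"
| "matrix_power S M (Suc n) = (\<lambda>x y. \<Sum>z\<in>S. M x z * matrix_power S M n z y)"

text \<open>
  The probability of being in state y at time t when started from x, i.e. the
  (x, y) entry of the matrix exponential of t times the generator.
\<close>

definition ctmc_prob :: "'s set \<Rightarrow> ('s \<Rightarrow> 's \<Rightarrow> real) \<Rightarrow> real \<Rightarrow> 's \<Rightarrow> 's \<Rightarrow> real" where
  "ctmc_prob S q t x y =
     (\<Sum>n. t ^ n / fact n * matrix_power S (ctmc_generator S q) n x y)"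

definition tv_dist :: "'s set \<Rightarrow> ('s \<Rightarrow> real) \<Rightarrow> ('s \<Rightarrow> real) \<Rightarrow> real" where
  "tv_dist S a b = (1 / 2) * (\<Sum>z\<in>S. \<bar>a z - b z\<bar>)"

text \<open>
  Mixing times are extended reals, with value \<open>\<infinity>\<close> if no time is
  admissible. If some time is admissible, the infimum is attained, because
  the transition probabilities are continuous in t.
\<close>

definition tv_mixing_time ::
  "'s set \<Rightarrow> ('s \<Rightarrow> 's \<Rightarrow> real) \<Rightarrow> ('s \<Rightarrow> real) \<Rightarrow> real \<Rightarrow> ereal" where
  "tv_mixing_time S q \<pi> \<epsilon> =
     Inf {ereal t | t. 0 \<le> t \<and> (\<forall>x\<in>S. tv_dist S (ctmc_prob S q t x) \<pi> \<le> \<epsilon>)}"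

definition Linf_mixing_time ::
  "'s set \<Rightarrow> ('s \<Rightarrow> 's \<Rightarrow> real) \<Rightarrow> ('s \<Rightarrow> real) \<Rightarrow> real \<Rightarrow> ereal" where
  "Linf_mixing_time S q \<pi> \<epsilon> =
     Inf {ereal t | t. 0 \<le> t \<and>
            (\<forall>z\<in>S. \<forall>w\<in>S. \<bar>ctmc_prob S q t z w / \<pi> w - 1\<bar> \<le> \<epsilon>)}"

section \<open>Simple random walk on the static graph\<close>

definition srw_matrix :: "'a set \<Rightarrow> 'a set set \<Rightarrow> 'a \<Rightarrow> 'a \<Rightarrow> real" where
  "srw_matrix V E x y = of_bool ({x, y} \<in> E) / real (deg V E x)"

definition srw_stat :: "'a set \<Rightarrow> 'a set set \<Rightarrow> 'a \<Rightarrow> real" where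
  "srw_stat V E x = real (deg V E x) / (2 * real (card E))"

definition is_eigenvalue :: "'s set \<Rightarrow> ('s \<Rightarrow> 's \<Rightarrow> real) \<Rightarrow> real \<Rightarrow> bool" where
  "is_eigenvalue S M \<theta> \<longleftrightarrow>
     (\<exists>f. (\<exists>x\<in>S. f x \<noteq> 0) \<and> (\<forall>x\<in>S. (\<Sum>y\<in>S. M x y * f y) = \<theta> * f x))"

text \<open>
  The matrix I - P is self-adjoint with respect to the stationary measure, so
  restricting to real eigenvalues loses nothing.
\<close>

definition srw_rel_time :: "'a set \<Rightarrow> 'a set set \<Rightarrow> real" where
  "srw_rel_time V E =
     1 / (LEAST \<theta>. 0 < \<theta> \<and>
            is_eigenvalue V (\<lambda>x y. of_bool (x = y) - srw_matrix V E x y) \<theta>)"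

text \<open>
  On the graph with two vertices the walk is within distance 1/2 of
  stationarity already at time 0, so the mixing time at 1/|V| is 0 there, and no
  multiple of it bounds the relaxation time times log |V|. For |V| at least 3
  the two are comparable.
\<close>

definition srw_tv_mixing_time :: "'a set \<Rightarrow> 'a set set \<Rightarrow> real \<Rightarrow> ereal" where
  "srw_tv_mixing_time V E \<epsilon> = tv_mixing_time V (srw_matrix V E) (srw_stat V E) \<epsilon>"

section \<open>Random walk on dynamical percolation\<close>

text \<open>
  An edge configuration in \<open>{0,1}\<^sup>E\<close> is represented by its set of open edges.
\<close>

definition full_states :: "'a set \<Rightarrow> 'a set set \<Rightarrow> ('a \<times> 'a set set) set" where
  "full_states V E = V \<times> Pow E"

text \<open>
  The first sum collects the refreshes of the edges, the second one the
  attempted jumps of the walk, which fail across closed edges.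
\<close>

definition full_rate ::
  "'a set \<Rightarrow> 'a set set \<Rightarrow> real \<Rightarrow> real \<Rightarrow>
     'a \<times> 'a set set \<Rightarrow> 'a \<times> 'a set set \<Rightarrow> real" where
  "full_rate V E \<mu> p = (\<lambda>(x, \<eta>) w.
     (\<Sum>e\<in>E. \<mu> * (p * of_bool (w = (x, insert e \<eta>))
                   + (1 - p) * of_bool (w = (x, \<eta> - {e}))))
   + (\<Sum>v\<in>nbrs V E x. 1 / real (deg V E x)
                   * of_bool (w = (if {x, v} \<in> \<eta> then v else x, \<eta>))))"

definition bernoulli_stat :: "'a set set \<Rightarrow> real \<Rightarrow> 'a set set \<Rightarrow> real" where
  "bernoulli_stat E p \<eta> = (\<Prod>e\<in>E. if e \<in> \<eta> then p else 1 - p)"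

definition full_stat ::
  "'a set \<Rightarrow> 'a set set \<Rightarrow> real \<Rightarrow> 'a \<times> 'a set set \<Rightarrow> real" where
  "full_stat V E p = (\<lambda>(x, \<eta>). srw_stat V E x * bernoulli_stat E p \<eta>)"

text \<open>
  For p = 1 the stationary measure vanishes on states with a closed edge. Division
  by zero yields zero there, so that, if E is nonempty, for \<open>\<epsilon> < 1\<close> no time is admissible and the
  mixing time is \<open>\<infinity>\<close>.
\<close>

definition full_Linf_mixing_time ::
  "'a set \<Rightarrow> 'a set set \<Rightarrow> real \<Rightarrow> real \<Rightarrow> real \<Rightarrow> ereal" where
  "full_Linf_mixing_time V E \<mu> p \<epsilon> =
     Linf_mixing_time (full_states V E) (full_rate V E \<mu> p) (full_stat V E p) \<epsilon>"

text \<open>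
  The quantity |log(1-p)|, with value \<open>\<infinity>\<close> at p = 1 (the library's \<open>ln 0\<close> is 0).
\<close>

definition abs_log_compl :: "real \<Rightarrow> ereal" where
  "abs_log_compl p = (if p = 1 then \<infinity> else ereal \<bar>ln (1 - p)\<bar>)"

end

theory Submission
  imports Defs "HOL-Analysis.Function_Topology" "HOL-Analysis.Convex"
begin

text \<open>
  The full process is reversible with spectral gap at least \<open>\<mu> p / (5 t_rel)\<close>. Indeed, write
  \<open>f\<close> for the average of \<open>F(x, \<eta>)\<close> over the environment. The variance of F splits into the variance
  of f under the stationary law of the walk, which is at most \<open>t_rel\<close> times the Dirichlet form
  of f, and the variance within the fibres, which the Efron-Stein inequality bounds by the
  refresh energy. For an edge \<open>e = {x, y}\<close>, comparing \<open>p (f x - f y)\<close> with the mean of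
  \<open>F(x, \<eta>) - F(y, \<eta>)\<close> over the configurations in which e is open leaves only covariances with
  the state of e, which the refresh energy of e controls; so the Dirichlet form of f is at
  most \<open>3 / p\<close> times the sum of the walk energy and the refresh energy.

  The state space is too large for the spectral gap alone to give the mixing time. But the
  return density of the full process is at most that of the environment divided by the stationary
  probability of the vertex, hence at most \<open>e |V|\<^sup>2\<close> after time
  \<open>(log |E| + |log p| + |log (1 - p)|) / \<mu>\<close>, and from there the gap gives a density within
  \<open>|V|\<^sup>-\<^sup>k\<close> of 1 after a further time of order \<open>k t_rel log |V| / (\<mu> p)\<close>.

  For the simple random walk, the same argument from time 0 bounds the mixing time above, and the
  decay of an eigenfunction of the spectral gap bounds it below.
\<close>

section \<open>Matrix exponentials and transition probabilities\<close>

text \<open>The exponential of an arbitrary matrix, not only of a generator: the positivity argument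
  shifts a generator by a multiple of the identity, and the result is no longer a generator.\<close>

definition mexp :: "'s set \<Rightarrow> ('s \<Rightarrow> 's \<Rightarrow> real) \<Rightarrow> real \<Rightarrow> 's \<Rightarrow> 's \<Rightarrow> real" where
  "mexp S M t x y = (\<Sum>n. t ^ n / fact n * matrix_power S M n x y)"

text \<open>The sum of all absolute entries dominates every absolute row sum, so each further factor
  costs at most this number. This crude bound suffices for entrywise convergence of the exponential
  series.\<close>

lemma matrix_power_bound:
  assumes "finite S" "x \<in> S"
  shows "\<bar>matrix_power S M n x y\<bar> \<le> (\<Sum>x\<in>S. \<Sum>z\<in>S. \<bar>M x z\<bar>) ^ n"
  using assms(2)
proof (induction n arbitrary: x)
  case (Suc n)
  let ?B = "\<Sum>x\<in>S. \<Sum>z\<in>S. \<bar>M x z\<bar>"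
  have B: "0 \<le> ?B" by (intro sum_nonneg) auto
  have "\<bar>matrix_power S M (Suc n) x y\<bar> \<le> (\<Sum>z\<in>S. \<bar>M x z\<bar> * ?B ^ n)"
    unfolding matrix_power.simps
    by (rule sum_abs[THEN order_trans], rule sum_mono)
       (simp add: abs_mult mult_left_mono Suc.IH)
  also have "\<dots> = (\<Sum>z\<in>S. \<bar>M x z\<bar>) * ?B ^ n" by (simp add: sum_distrib_right)
  also have "\<dots> \<le> ?B * ?B ^ n"
    using assms(1) Suc.prems B
    by (intro mult_right_mono member_le_sum[where f = "\<lambda>x. \<Sum>z\<in>S. \<bar>M x z\<bar>"])
       (auto intro: sum_nonneg)
  finally show ?case by simp
qed auto

text \<open>The recursion splits off a factor on the left. Splitting on the right is needed to
  commute a matrix with its exponential and to reverse paths under detailed balance.\<close>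

lemma matrix_power_Suc_right:
  assumes "finite S" "x \<in> S" "y \<in> S"
  shows "matrix_power S M (Suc n) x y = (\<Sum>z\<in>S. matrix_power S M n x z * M z y)"
  using assms(2)
proof (induction n arbitrary: x)
  case 0
  then show ?case using assms by simp
next
  case (Suc n)
  have "matrix_power S M (Suc (Suc n)) x y
      = (\<Sum>z\<in>S. M x z * (\<Sum>w\<in>S. matrix_power S M n z w * M w y))"
    using Suc.IH by (subst matrix_power.simps) (auto intro!: sum.cong simp del: matrix_power.simps)
  also have "\<dots> = (\<Sum>w\<in>S. matrix_power S M (Suc n) x w * M w y)"
    by (simp add: sum_distrib_left sum_distrib_right mult.assoc) (rule sum.swap)
  finally show ?case .
qed

lemma summable_mexp:
  assumes "finite S" "x \<in> S"
  shows "summable (\<lambda>n. t ^ n / fact n * matrix_power S M n x y)"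
proof (rule summable_comparison_test')
  let ?B = "\<Sum>x\<in>S. \<Sum>z\<in>S. \<bar>M x z\<bar>"
  show "summable (\<lambda>n. inverse (fact n) * (\<bar>t\<bar> * ?B) ^ n)" by (rule summable_exp)
  fix n
  show "norm (t ^ n / fact n * matrix_power S M n x y) \<le> inverse (fact n) * (\<bar>t\<bar> * ?B) ^ n"
    using matrix_power_bound[OF assms, of M n y]
    by (simp add: abs_mult power_abs power_mult_distrib field_simps mult_left_mono)
qed

lemma mexp_sums:
  assumes "finite S" "x \<in> S"
  shows "(\<lambda>n. t ^ n / fact n * matrix_power S M n x y) sums mexp S M t x y"
  unfolding mexp_def using summable_mexp[OF assms] by (rule summable_sums)

lemma mexp_0: "mexp S M 0 x y = of_bool (x = y)"
proof -
  have "(\<lambda>n. (0::real) ^ n / fact n * matrix_power S M n x y)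
      = (\<lambda>n. if n = 0 then of_bool (x = y) else 0)"
    by (auto simp: power_0_left)
  then have "(\<lambda>n. (0::real) ^ n / fact n * matrix_power S M n x y) sums (of_bool (x = y))"
    using sums_single[of 0 "\<lambda>n. of_bool (x = y) :: real"] by simp
  then show ?thesis unfolding mexp_def by (simp add: sums_iff)
qed

lemma mexp_deriv:
  assumes "finite S" "x \<in> S"
  shows "((\<lambda>t. mexp S M t x y) has_real_derivative (\<Sum>z\<in>S. M x z * mexp S M t z y)) (at t)"
proof -
  let ?c = "\<lambda>n. matrix_power S M n x y / fact n"
  have s: "summable (\<lambda>n. ?c n * t ^ n)" for t
    using summable_mexp[OF assms, of t M y] by (simp add: mult.commute)
  \<comment> \<open>Termwise differentiation at \<open>t\<close> needs convergence at a point of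
    larger modulus; \<open>\<bar>t\<bar> + 1\<close> is one.\<close>
  have d: "((\<lambda>t. \<Sum>n. ?c n * t ^ n) has_real_derivative (\<Sum>n. diffs ?c n * t ^ n)) (at t)"
    by (rule termdiffs_strong[OF s, of _ "\<bar>t\<bar> + 1"]) simp
  have "diffs ?c n * t ^ n = (\<Sum>z\<in>S. M x z * (t ^ n / fact n * matrix_power S M n z y))" for n
    by (simp add: diffs_def sum_distrib_left sum_divide_distrib sum_distrib_right divide_simps
        add_nonneg_eq_0_iff) (simp add: mult_ac)
  moreover have "(\<lambda>n. \<Sum>z\<in>S. M x z * (t ^ n / fact n * matrix_power S M n z y)) sums
      (\<Sum>z\<in>S. M x z * mexp S M t z y)"
    by (intro sums_sum sums_mult mexp_sums assms(1))
  ultimately have "(\<Sum>n. diffs ?c n * t ^ n) = (\<Sum>z\<in>S. M x z * mexp S M t z y)"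
    by (simp add: sums_iff)
  moreover have "(\<lambda>t. \<Sum>n. ?c n * t ^ n) = (\<lambda>t. mexp S M t x y)"
    by (simp add: mexp_def mult.commute)
  ultimately show ?thesis using d by simp
qed

lemma mexp_commute:
  assumes "finite S" "x \<in> S" "y \<in> S"
  shows "(\<Sum>z\<in>S. M x z * mexp S M t z y) = (\<Sum>z\<in>S. mexp S M t x z * M z y)"
proof -
  have "(\<Sum>z\<in>S. M x z * mexp S M t z y)
      = (\<Sum>n. \<Sum>z\<in>S. M x z * (t ^ n / fact n * matrix_power S M n z y))"
  proof -
    have "(\<lambda>n. \<Sum>z\<in>S. M x z * (t ^ n / fact n * matrix_power S M n z y)) sums
        (\<Sum>z\<in>S. M x z * mexp S M t z y)"
      by (intro sums_sum sums_mult mexp_sums assms(1))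
    then show ?thesis by (simp add: sums_iff)
  qed
  also have "\<dots> = (\<Sum>n. t ^ n / fact n * matrix_power S M (Suc n) x y)"
    by (simp add: sum_distrib_left mult_ac)
  also have "\<dots> = (\<Sum>n. \<Sum>z\<in>S. t ^ n / fact n * matrix_power S M n x z * M z y)"
    unfolding matrix_power_Suc_right[OF assms] by (simp add: sum_distrib_left mult_ac)
  also have "\<dots> = (\<Sum>z\<in>S. mexp S M t x z * M z y)"
  proof -
    have "(\<lambda>n. \<Sum>z\<in>S. t ^ n / fact n * matrix_power S M n x z * M z y) sums
        (\<Sum>z\<in>S. mexp S M t x z * M z y)"
      by (intro sums_sum sums_mult2 mexp_sums assms(1,2))
    then show ?thesis by (simp add: sums_iff)
  qed
  finally show ?thesis .
qed

text \<open>Uniqueness for the linear system \<open>u' = M u\<close>: the sum of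
  \<open>mexp S M (t - s) x y * u s y\<close> over y does not depend on s.\<close>

lemma mexp_unique:
  assumes "finite S"
    and u: "\<And>t x. x \<in> S \<Longrightarrow> ((\<lambda>t. u t x) has_real_derivative (\<Sum>y\<in>S. M x y * u t y)) (at t)"
    and "x \<in> S"
  shows "u t x = (\<Sum>y\<in>S. mexp S M t x y * u 0 y)"
proof -
  let ?\<phi> = "\<lambda>s. \<Sum>y\<in>S. mexp S M (t - s) x y * u s y"
  have "(?\<phi> has_real_derivative 0) (at s)" for s
  proof -
    have d: "((\<lambda>s. mexp S M (t - s) x y) has_real_derivative
        - (\<Sum>z\<in>S. mexp S M (t - s) x z * M z y)) (at s)" if "y \<in> S" for y
    proof -
      have "((\<lambda>s. mexp S M (t - s) x y) has_real_derivative
        (\<Sum>z\<in>S. M x z * mexp S M (t - s) z y) * (- 1)) (at s)"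
        by (rule DERIV_chain'[OF _ mexp_deriv[OF assms(1,3)]]) (auto intro!: derivative_eq_intros)
      then show ?thesis using mexp_commute[OF assms(1,3) that] by simp
    qed
    have "(?\<phi> has_real_derivative (\<Sum>y\<in>S.
          - (\<Sum>z\<in>S. mexp S M (t - s) x z * M z y) * u s y
          + (\<Sum>z\<in>S. M y z * u s z) * mexp S M (t - s) x y)) (at s)"
      by (intro DERIV_sum DERIV_mult d u) auto
    moreover have "(\<Sum>y\<in>S. (\<Sum>z\<in>S. mexp S M (t - s) x z * M z y) * u s y)
        = (\<Sum>y\<in>S. (\<Sum>z\<in>S. M y z * u s z) * mexp S M (t - s) x y)"
      by (simp add: sum_distrib_right sum_distrib_left mult_ac) (subst sum.swap, simp)
    ultimately show ?thesis by (simp add: sum.distrib sum_negf sum_subtractf)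
  qed
  then have "?\<phi> t = ?\<phi> 0" by (intro DERIV_isconst_all) auto
  moreover have "?\<phi> t = u t x" using assms(1,3) by (simp add: mexp_0)
  ultimately show ?thesis by simp
qed

text \<open>With \<open>t\<close> and \<open>y\<close> fixed, \<open>mexp S M (s + t) x y\<close>
  solves the linear system in \<open>s\<close>, with initial value the exponential at time
  \<open>t\<close>; uniqueness gives the semigroup law.\<close>

lemma mexp_add:
  assumes "finite S" "x \<in> S"
  shows "mexp S M (s + t) x y = (\<Sum>z\<in>S. mexp S M s x z * mexp S M t z y)"
proof -
  have "mexp S M (s + t) x y = (\<Sum>z\<in>S. mexp S M s x z * mexp S M (0 + t) z y)"
  proof (rule mexp_unique[where u = "\<lambda>s x. mexp S M (s + t) x y", OF assms(1) _ assms(2)])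
    fix s x assume "x \<in> S"
    then show "((\<lambda>s. mexp S M (s + t) x y) has_real_derivative
        (\<Sum>z\<in>S. M x z * mexp S M (s + t) z y)) (at s)"
      using mexp_deriv[OF assms(1), of x M y "s + t"]
      by (simp only: DERIV_shift[of "\<lambda>t. mexp S M t x y"])
  qed
  then show ?thesis by simp
qed

text \<open>The scalar factor cancels the added multiple of the identity in the derivative, so the
  right-hand side solves the system for \<open>M\<close> and uniqueness applies.\<close>

lemma mexp_shift:
  assumes "finite S" "x \<in> S" "y \<in> S"
  shows "mexp S M t x y = exp (- (c * t)) * mexp S (\<lambda>x y. M x y + c * of_bool (x = y)) t x y"
proof -
  let ?N = "\<lambda>x y. M x y + c * of_bool (x = y)"
  have "exp (- (c * t)) * mexp S ?N t x y
      = (\<Sum>z\<in>S. mexp S M t x z * (exp (- (c * 0)) * mexp S ?N 0 z y))"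
  proof (rule mexp_unique[where u = "\<lambda>t x. exp (- (c * t)) * mexp S ?N t x y", OF assms(1) _ assms(2)])
    fix t x assume x: "x \<in> S"
    have "((\<lambda>t. exp (- (c * t)) * mexp S ?N t x y) has_real_derivative
       exp (- (c * t)) * (- c) * mexp S ?N t x y
       + (\<Sum>z\<in>S. ?N x z * mexp S ?N t z y) * exp (- (c * t))) (at t)"
      by (intro DERIV_mult mexp_deriv assms(1) x) (auto intro!: derivative_eq_intros)
    moreover have "(\<Sum>z\<in>S. ?N x z * mexp S ?N t z y)
        = (\<Sum>z\<in>S. M x z * mexp S ?N t z y) + c * mexp S ?N t x y"
    proof -
      have "(\<Sum>z\<in>S. c * of_bool (x = z) * mexp S ?N t z y)
          = (\<Sum>z\<in>S. if x = z then c * mexp S ?N t z y else 0)"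
        by (rule sum.cong) auto
      then show ?thesis using x assms(1) by (simp add: distrib_right sum.distrib)
    qed
    then have "exp (- (c * t)) * (- c) * mexp S ?N t x y
        + (\<Sum>z\<in>S. ?N x z * mexp S ?N t z y) * exp (- (c * t))
        = (\<Sum>z\<in>S. M x z * (exp (- (c * t)) * mexp S ?N t z y))"
      by (simp add: algebra_simps sum_distrib_left)
    ultimately show "((\<lambda>t. exp (- (c * t)) * mexp S ?N t x y) has_real_derivative
       (\<Sum>z\<in>S. M x z * (exp (- (c * t)) * mexp S ?N t z y))) (at t)"
      by (simp only:)
  qed
  then show ?thesis using assms by (simp add: mexp_0)
qed

lemma mexp_nonneg:
  assumes "finite S" "\<And>x y. x \<in> S \<Longrightarrow> y \<in> S \<Longrightarrow> 0 \<le> M x y" "x \<in> S" "y \<in> S" "0 \<le> t"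
  shows "0 \<le> mexp S M t x y"
proof -
  have "0 \<le> matrix_power S M n x y" for n
    using assms(3) by (induction n arbitrary: x) (auto intro!: sum_nonneg mult_nonneg_nonneg assms(2))
  then show ?thesis unfolding mexp_def
    using assms by (intro suminf_nonneg summable_mexp) auto
qed

lemma ctmc_prob_eq_mexp: "ctmc_prob S q = mexp S (ctmc_generator S q)"
  by (intro ext) (simp add: ctmc_prob_def mexp_def)

text \<open>Uniformization: the diagonal of a generator may be negative, but adding a constant at
  least as large as every exit rate makes all entries nonnegative, and the shift costs only a
  positive scalar factor.\<close>

lemma ctmc_prob_nonneg:
  assumes "finite S" "\<And>x y. x \<in> S \<Longrightarrow> y \<in> S \<Longrightarrow> 0 \<le> q x y" "x \<in> S" "y \<in> S" "0 \<le> t"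
  shows "0 \<le> ctmc_prob S q t x y"
proof -
  \<comment> \<open>The total of all rates is a convenient common bound for the exit rates.\<close>
  define c where "c = (\<Sum>x\<in>S. \<Sum>z\<in>S. q x z)"
  have c: "(\<Sum>z\<in>S. q x z) \<le> c" if "x \<in> S" for x
    unfolding c_def using assms that
    by (intro member_le_sum[where f = "\<lambda>x. \<Sum>z\<in>S. q x z"]) (auto intro: sum_nonneg)
  have "0 \<le> exp (- (c * t)) * mexp S (\<lambda>x y. ctmc_generator S q x y + c * of_bool (x = y)) t x y"
  proof (intro mult_nonneg_nonneg mexp_nonneg)
    fix x y assume "x \<in> S" "y \<in> S"
    then show "0 \<le> ctmc_generator S q x y + c * of_bool (x = y)"
      using c[of x] assms(2)[of x y] by (auto simp: ctmc_generator_def)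
  qed (use assms in auto)
  then show ?thesis
    by (simp only: ctmc_prob_eq_mexp mexp_shift[OF assms(1,3,4), of _ t c, symmetric])
qed

section \<open>Reversible chains\<close>

text \<open>Strict positivity of the stationary weights allows division by them, so that densities
  with respect to \<open>\<pi>\<close> make sense.\<close>

locale reversible_chain =
  fixes S :: "'s set" and q :: "'s \<Rightarrow> 's \<Rightarrow> real" and \<pi> :: "'s \<Rightarrow> real"
  assumes finite_states: "finite S"
    and stat_pos: "x \<in> S \<Longrightarrow> 0 < \<pi> x"
    and stat_sum: "sum \<pi> S = 1"
    and rate_nonneg: "x \<in> S \<Longrightarrow> y \<in> S \<Longrightarrow> 0 \<le> q x y"
    and balance: "x \<in> S \<Longrightarrow> y \<in> S \<Longrightarrow> \<pi> x * q x y = \<pi> y * q y x"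
begin

abbreviation "L \<equiv> ctmc_generator S q"
abbreviation "P \<equiv> ctmc_prob S q"

definition dirichlet :: "('s \<Rightarrow> real) \<Rightarrow> real" where
  "dirichlet f = (1/2) * (\<Sum>x\<in>S. \<Sum>y\<in>S. \<pi> x * q x y * (f x - f y)\<^sup>2)"

text \<open>The variational form of a spectral gap of at least \<open>\<gamma>\<close>. For
  functions of mean zero the variance is the second moment.\<close>

definition poincare :: "real \<Rightarrow> bool" where
  "poincare \<gamma> \<longleftrightarrow>
     (\<forall>f. (\<Sum>x\<in>S. \<pi> x * f x) = 0 \<longrightarrow> \<gamma> * (\<Sum>x\<in>S. \<pi> x * (f x)\<^sup>2) \<le> dirichlet f)"

section \<open>Generator, Dirichlet form and detailed balance\<close>

lemma generator_apply:
  assumes "x \<in> S"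
  shows "(\<Sum>y\<in>S. L x y * f y) = (\<Sum>y\<in>S. q x y * (f y - f x))"
proof -
  have "(\<Sum>y\<in>S. L x y * f y) = (\<Sum>y\<in>S. q x y * f y) - (\<Sum>y\<in>S. if x = y then (\<Sum>z\<in>S. q x z) * f y else 0)"
    by (simp add: ctmc_generator_def left_diff_distrib sum_subtractf[symmetric] if_distrib cong: if_cong)
      (auto intro!: sum.cong simp: left_diff_distrib)
  then show ?thesis
    using assms finite_states by (simp add: right_diff_distrib sum_subtractf sum_distrib_right)
qed

lemma generator_balance:
  assumes "x \<in> S" "y \<in> S"
  shows "\<pi> x * L x y = \<pi> y * L y x"
  using balance[OF assms] by (auto simp: ctmc_generator_def)

text \<open>Summation by parts: detailed balance allows the names of the two states to be exchanged
  in the double sum, and averaging the two forms produces the product of differences.\<close>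

lemma generator_bilinear:
  "(\<Sum>x\<in>S. \<pi> x * (g x * (\<Sum>y\<in>S. L x y * f y)))
     = - (1/2) * (\<Sum>x\<in>S. \<Sum>y\<in>S. \<pi> x * q x y * ((f x - f y) * (g x - g y)))"
proof -
  let ?T = "\<Sum>x\<in>S. \<Sum>y\<in>S. \<pi> x * q x y * (g x * (f y - f x))"
  have "(\<Sum>x\<in>S. \<pi> x * (g x * (\<Sum>y\<in>S. L x y * f y))) = ?T"
    by (rule sum.cong[OF refl]) (simp only: generator_apply, simp add: sum_distrib_left mult_ac)
  moreover have "?T = (\<Sum>y\<in>S. \<Sum>x\<in>S. \<pi> y * q y x * (g x * (f y - f x)))"
    by (subst sum.swap) (intro sum.cong refl, simp add: balance)
  then have "?T + ?T = (\<Sum>x\<in>S. \<Sum>y\<in>S. - (\<pi> x * q x y * ((f x - f y) * (g x - g y))))"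
    by (subst (2) \<open>?T = _\<close>, unfold sum.distrib[symmetric])
       (intro sum.cong refl, simp add: algebra_simps)
  ultimately show ?thesis by (simp add: sum_negf)
qed

lemma generator_dirichlet:
  "(\<Sum>x\<in>S. \<pi> x * (f x * (\<Sum>y\<in>S. L x y * f y))) = - dirichlet f"
  unfolding generator_bilinear dirichlet_def by (simp add: power2_eq_square)

lemma generator_stationary: "(\<Sum>x\<in>S. \<pi> x * (\<Sum>y\<in>S. L x y * f y)) = 0"
  using generator_bilinear[of "\<lambda>_. 1" f] by simp

lemma dirichlet_nonneg: "0 \<le> dirichlet f"
  unfolding dirichlet_def
  by (intro mult_nonneg_nonneg sum_nonneg) (auto intro: rate_nonneg less_imp_le[OF stat_pos])

section \<open>The transition semigroup and its decay\<close>

lemma prob_0: "P 0 x y = of_bool (x = y)"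
  by (simp add: ctmc_prob_eq_mexp mexp_0)

lemma prob_add:
  assumes "x \<in> S"
  shows "P (s + t) x y = (\<Sum>z\<in>S. P s x z * P t z y)"
  unfolding ctmc_prob_eq_mexp by (rule mexp_add[OF finite_states assms])

lemma prob_unique:
  assumes "\<And>t x. x \<in> S \<Longrightarrow> ((\<lambda>t. u t x) has_real_derivative (\<Sum>y\<in>S. L x y * u t y)) (at t)"
    and "x \<in> S"
  shows "u t x = (\<Sum>y\<in>S. P t x y * u 0 y)"
  unfolding ctmc_prob_eq_mexp by (rule mexp_unique[OF finite_states assms])

lemma prob_row_sum:
  assumes "x \<in> S"
  shows "(\<Sum>y\<in>S. P t x y) = 1"
  using prob_unique[of "\<lambda>_ _. 1", OF _ assms, of t]
  by (simp add: generator_apply[of _ "\<lambda>_. 1", simplified])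

lemma prob_nonneg: "x \<in> S \<Longrightarrow> y \<in> S \<Longrightarrow> 0 \<le> t \<Longrightarrow> 0 \<le> P t x y"
  by (intro ctmc_prob_nonneg finite_states rate_nonneg)

text \<open>Detailed balance of the generator passes to its powers by induction, peeling one factor
  from the left on one side and from the right on the other, and then to the series.\<close>

lemma prob_balance:
  assumes "x \<in> S" "y \<in> S"
  shows "\<pi> x * P t x y = \<pi> y * P t y x"
proof -
  have m: "\<pi> x * matrix_power S L n x y = \<pi> y * matrix_power S L n y x" for n
    using assms(1)
  proof (induction n arbitrary: x)
    case (Suc n)
    have "\<pi> x * matrix_power S L (Suc n) x y = (\<Sum>z\<in>S. L z x * (\<pi> z * matrix_power S L n z y))"
      unfolding matrix_power.simps sum_distrib_left mult.assoc[symmetric]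
      by (rule sum.cong[OF refl]) (simp add: generator_balance[OF Suc.prems])
    also have "\<dots> = (\<Sum>z\<in>S. \<pi> y * (matrix_power S L n y z * L z x))"
      by (rule sum.cong[OF refl]) (simp add: Suc.IH)
    also have "\<dots> = \<pi> y * matrix_power S L (Suc n) y x"
      by (simp only: matrix_power_Suc_right[OF finite_states assms(2) Suc.prems] sum_distrib_left)
    finally show ?case .
  qed auto
  have "\<pi> x * P t x y = (\<Sum>n. \<pi> x * (t ^ n / fact n * matrix_power S L n x y))"
    unfolding ctmc_prob_def
    by (rule suminf_mult[symmetric]) (rule summable_mexp[OF finite_states assms(1)])
  also have "\<dots> = (\<Sum>n. \<pi> y * (t ^ n / fact n * matrix_power S L n y x))"
    by (rule arg_cong[where f = suminf], rule ext) (use m in \<open>simp add: mult.left_commute\<close>)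
  also have "\<dots> = \<pi> y * P t y x"
    unfolding ctmc_prob_def
    by (rule suminf_mult) (rule summable_mexp[OF finite_states assms(2)])
  finally show ?thesis .
qed

lemma prob_stationary:
  assumes "y \<in> S"
  shows "(\<Sum>x\<in>S. \<pi> x * P t x y) = \<pi> y"
proof -
  have "(\<Sum>x\<in>S. \<pi> x * P t x y) = (\<Sum>x\<in>S. \<pi> y * P t y x)"
    by (rule sum.cong[OF refl]) (simp add: prob_balance assms)
  then show ?thesis using prob_row_sum[OF assms, of t] by (simp add: sum_distrib_left[symmetric])
qed

lemma prob_apply_deriv:
  assumes "x \<in> S"
  shows "((\<lambda>t. \<Sum>y\<in>S. P t x y * f y) has_real_derivative
           (\<Sum>z\<in>S. L x z * (\<Sum>y\<in>S. P t z y * f y))) (at t)"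
proof -
  have "((\<lambda>t. \<Sum>y\<in>S. P t x y * f y) has_real_derivative
           (\<Sum>y\<in>S. (\<Sum>z\<in>S. L x z * P t z y) * f y)) (at t)"
    unfolding ctmc_prob_eq_mexp by (intro DERIV_sum DERIV_cmult_right mexp_deriv finite_states assms)
  moreover have "(\<Sum>y\<in>S. (\<Sum>z\<in>S. L x z * P t z y) * f y) = (\<Sum>z\<in>S. L x z * (\<Sum>y\<in>S. P t z y * f y))"
    by (simp add: sum_distrib_left sum_distrib_right mult.assoc) (rule sum.swap)
  ultimately show ?thesis by simp
qed

lemma prob_mean:
  assumes "(\<Sum>x\<in>S. \<pi> x * f x) = 0"
  shows "(\<Sum>x\<in>S. \<pi> x * (\<Sum>y\<in>S. P t x y * f y)) = 0"
proof -
  have "(\<Sum>x\<in>S. \<pi> x * (\<Sum>y\<in>S. P t x y * f y)) = (\<Sum>y\<in>S. (\<Sum>x\<in>S. \<pi> x * P t x y) * f y)"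
    by (simp add: sum_distrib_left sum_distrib_right mult.assoc) (rule sum.swap)
  then show ?thesis using assms by (simp add: prob_stationary)
qed

text \<open>A Gronwall argument: the squared norm of the evolved function has derivative minus twice
  its Dirichlet form, and the evolved function keeps mean zero, so the norm multiplied by the
  exponential weight is nonincreasing.\<close>

lemma poincare_contraction:
  assumes "poincare \<gamma>" "(\<Sum>x\<in>S. \<pi> x * f x) = 0" "0 \<le> t"
  shows "(\<Sum>x\<in>S. \<pi> x * (\<Sum>y\<in>S. P t x y * f y)\<^sup>2) \<le> exp (- 2 * \<gamma> * t) * (\<Sum>x\<in>S. \<pi> x * (f x)\<^sup>2)"
proof -
  define F where "F t x = (\<Sum>y\<in>S. P t x y * f y)" for t x
  define N where "N t = (\<Sum>x\<in>S. \<pi> x * (F t x)\<^sup>2)" for t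
  have dN: "(N has_real_derivative - 2 * dirichlet (F t)) (at t)" for t
  proof -
    have "(N has_real_derivative (\<Sum>x\<in>S. \<pi> x * (2 * F t x * (\<Sum>y\<in>S. L x y * F t y)))) (at t)"
      unfolding N_def
    proof (intro DERIV_sum DERIV_cmult)
      fix x assume "x \<in> S"
      then show "((\<lambda>t. (F t x)\<^sup>2) has_real_derivative 2 * F t x * (\<Sum>y\<in>S. L x y * F t y)) (at t)"
        using DERIV_power[OF prob_apply_deriv, where n = 2] unfolding F_def by (simp add: mult_ac)
    qed
    moreover have "(\<Sum>x\<in>S. \<pi> x * (2 * F t x * (\<Sum>y\<in>S. L x y * F t y))) = - 2 * dirichlet (F t)"
    proof -
      have "(\<Sum>x\<in>S. \<pi> x * (2 * F t x * (\<Sum>y\<in>S. L x y * F t y)))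
          = 2 * (\<Sum>x\<in>S. \<pi> x * (F t x * (\<Sum>y\<in>S. L x y * F t y)))"
        unfolding sum_distrib_left[of 2] by (intro sum.cong) auto
      then show ?thesis by (simp add: generator_dirichlet)
    qed
    ultimately show ?thesis by simp
  qed
  have "exp (2 * \<gamma> * t) * N t \<le> exp (2 * \<gamma> * 0) * N 0"
  proof (rule DERIV_nonpos_imp_nonincreasing[OF assms(3)])
    fix s
    have "((\<lambda>t. exp (2 * \<gamma> * t) * N t) has_real_derivative
        exp (2 * \<gamma> * s) * (2 * \<gamma>) * N s + - 2 * dirichlet (F s) * exp (2 * \<gamma> * s)) (at s)"
      by (intro DERIV_mult dN) (auto intro!: derivative_eq_intros)
    moreover have "\<gamma> * N s \<le> dirichlet (F s)"
      using assms(1) prob_mean[OF assms(2), of s] unfolding poincare_def N_def F_def by simp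
    then have "exp (2 * \<gamma> * s) * (\<gamma> * N s) \<le> exp (2 * \<gamma> * s) * dirichlet (F s)"
      by (rule mult_left_mono) simp
    then have "exp (2 * \<gamma> * s) * (2 * \<gamma>) * N s + - 2 * dirichlet (F s) * exp (2 * \<gamma> * s) \<le> 0"
      by (simp add: mult_ac)
    ultimately show "\<exists>y. ((\<lambda>t. exp (2 * \<gamma> * t) * N t) has_real_derivative y) (at s) \<and> y \<le> 0" by blast
  qed
  moreover have "N 0 = (\<Sum>x\<in>S. \<pi> x * (f x)\<^sup>2)"
    unfolding N_def F_def using finite_states by (intro sum.cong refl) (simp add: prob_0)
  ultimately show ?thesis
    by (simp add: N_def F_def exp_minus field_simps)
qed

lemma weighted_Cauchy_Schwarz:
  "(\<Sum>x\<in>S. \<pi> x * (f x * g x))\<^sup>2 \<le> (\<Sum>x\<in>S. \<pi> x * (f x)\<^sup>2) * (\<Sum>x\<in>S. \<pi> x * (g x)\<^sup>2)"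
proof -
  have "(\<Sum>x\<in>S. sqrt (\<pi> x) * f x * (sqrt (\<pi> x) * g x)) = (\<Sum>x\<in>S. \<pi> x * (f x * g x))"
    by (intro sum.cong refl) (use stat_pos in \<open>fastforce simp: less_imp_le\<close>)
  moreover have "(\<Sum>x\<in>S. (sqrt (\<pi> x) * f x)\<^sup>2) = (\<Sum>x\<in>S. \<pi> x * (f x)\<^sup>2)" for f
    using stat_pos by (intro sum.cong refl) (simp add: power_mult_distrib less_imp_le)
  ultimately show ?thesis
    using Cauchy_Schwarz_ineq_sum[of "\<lambda>x. sqrt (\<pi> x) * f x" "\<lambda>x. sqrt (\<pi> x) * g x" S] by simp
qed

text \<open>The density at time \<open>2t + s\<close> minus 1 is the scalar product of the centered density
  of z at time t with the image under the semigroup, run for time s, of that of w.\<close>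

lemma density_bound:
  assumes "poincare \<gamma>" "z \<in> S" "w \<in> S" "0 \<le> s"
  shows "\<bar>P (t + (s + t)) z w / \<pi> w - 1\<bar>
           \<le> exp (- \<gamma> * s) * sqrt (P (t + t) z z / \<pi> z * (P (t + t) w w / \<pi> w))"
proof -
  define g where "g z v = P t z v / \<pi> v - 1" for z v
  have pi0: "\<pi> v \<noteq> 0" if "v \<in> S" for v using stat_pos[OF that] by simp
  have pg: "\<pi> v * g z v = P t z v - \<pi> v" if "v \<in> S" for z v
    using pi0[OF that] by (simp add: g_def right_diff_distrib)
  have mean: "(\<Sum>v\<in>S. \<pi> v * g z v) = 0" if "z \<in> S" for z
    by (simp add: pg sum_subtractf prob_row_sum[OF that] stat_sum)
  \<comment> \<open>Applying the semigroup for time \<open>r\<close> to the centered density of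
    \<open>w\<close> at time \<open>t\<close> gives its centered density at time
    \<open>r + t\<close>.\<close>
  have Pg: "(\<Sum>u\<in>S. P r v u * g w u) = P (r + t) v w / \<pi> w - 1" if "v \<in> S" "w \<in> S" for r v w
  proof -
    have "(\<Sum>u\<in>S. P r v u * g w u) = (\<Sum>u\<in>S. P r v u * P t u w / \<pi> w - P r v u)"
    proof (rule sum.cong[OF refl])
      fix u assume u: "u \<in> S"
      \<comment> \<open>By reversibility the density is symmetric in its two states; this moves
        \<open>w\<close> to the endpoint, where the semigroup law applies.\<close>
      have "P t w u / \<pi> u = P t u w / \<pi> w"
        using prob_balance[OF u that(2), of t] pi0[OF u] pi0[OF that(2)] by (simp add: field_simps)
      then show "P r v u * g w u = P r v u * P t u w / \<pi> w - P r v u"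
        by (simp add: g_def right_diff_distrib)
    qed
    then show ?thesis
      by (simp add: sum_subtractf sum_divide_distrib[symmetric] prob_add[OF that(1)]
          prob_row_sum[OF that(1)])
  qed
  \<comment> \<open>The squared norm of a centered density is the return density at twice the time,
    minus 1; the 1 is dropped.\<close>
  have norm_g: "(\<Sum>v\<in>S. \<pi> v * (g z v)\<^sup>2) \<le> P (t + t) z z / \<pi> z" if z: "z \<in> S" for z
  proof -
    have "(\<Sum>v\<in>S. \<pi> v * (g z v)\<^sup>2) = (\<Sum>v\<in>S. (P t z v - \<pi> v) * g z v)"
      by (intro sum.cong refl) (simp add: power2_eq_square pg mult.assoc[symmetric])
    also have "\<dots> = P (t + t) z z / \<pi> z - 1"
      using mean[OF z] Pg[OF z z, of t] by (simp add: left_diff_distrib sum_subtractf)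
    finally show ?thesis by simp
  qed
  define h where "h v = (\<Sum>u\<in>S. P s v u * g w u)" for v
  have "(\<Sum>v\<in>S. \<pi> v * (g z v * h v)) = P (t + (s + t)) z w / \<pi> w - 1"
  proof -
    have "(\<Sum>v\<in>S. \<pi> v * (g z v * h v)) = (\<Sum>v\<in>S. P t z v * h v) - (\<Sum>v\<in>S. \<pi> v * h v)"
      by (simp add: mult.assoc[symmetric] pg left_diff_distrib sum_subtractf)
    moreover have "(\<Sum>v\<in>S. \<pi> v * h v) = 0"
      unfolding h_def by (rule prob_mean[OF mean[OF assms(3)]])
    moreover have "(\<Sum>v\<in>S. P t z v * h v) = (\<Sum>v\<in>S. P t z v * P (s + t) v w / \<pi> w - P t z v)"
      unfolding h_def by (intro sum.cong refl) (simp add: Pg assms right_diff_distrib)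
    then have "(\<Sum>v\<in>S. P t z v * h v) = P (t + (s + t)) z w / \<pi> w - 1"
      by (simp only: sum_subtractf sum_divide_distrib[symmetric] prob_add[OF assms(2), of t "s + t"]
          prob_row_sum[OF assms(2)])
    ultimately show ?thesis by simp
  qed
  moreover have "(\<Sum>v\<in>S. \<pi> v * (g z v * h v))\<^sup>2
      \<le> P (t + t) z z / \<pi> z * (exp (- 2 * \<gamma> * s) * (P (t + t) w w / \<pi> w))"
  proof -
    have nn: "0 \<le> (\<Sum>v\<in>S. \<pi> v * (f v)\<^sup>2)" for f
      by (intro sum_nonneg) (simp add: less_imp_le stat_pos)
    have "(\<Sum>v\<in>S. \<pi> v * (h v)\<^sup>2) \<le> exp (- 2 * \<gamma> * s) * (\<Sum>v\<in>S. \<pi> v * (g w v)\<^sup>2)"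
      unfolding h_def by (rule poincare_contraction[OF assms(1) mean[OF assms(3)] assms(4)])
    also have "\<dots> \<le> exp (- 2 * \<gamma> * s) * (P (t + t) w w / \<pi> w)"
      by (rule mult_left_mono[OF norm_g[OF assms(3)]]) simp
    finally show ?thesis
      using mult_mono[OF norm_g[OF assms(2)] _ order_trans[OF nn norm_g[OF assms(2)]] nn]
      by (intro order_trans[OF weighted_Cauchy_Schwarz])
  qed
  ultimately have "\<bar>P (t + (s + t)) z w / \<pi> w - 1\<bar>
      \<le> sqrt (P (t + t) z z / \<pi> z * (exp (- 2 * \<gamma> * s) * (P (t + t) w w / \<pi> w)))"
    using real_le_rsqrt by (simp add: real_le_rsqrt)
  also have "\<dots> = sqrt ((exp (- \<gamma> * s))\<^sup>2 * (P (t + t) z z / \<pi> z * (P (t + t) w w / \<pi> w)))"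
    by (simp add: exp_double[symmetric] mult_ac)
  also have "\<dots> = exp (- \<gamma> * s) * sqrt (P (t + t) z z / \<pi> z * (P (t + t) w w / \<pi> w))"
    by (subst real_sqrt_mult) simp
  finally show ?thesis .
qed

end

section \<open>The spectral gap\<close>

text \<open>The first-order condition at a minimum: for small steps of the right sign a nonzero
  linear term would beat the quadratic one.\<close>

lemma quadratic_nonneg_imp_linear_zero:
  fixes a c :: real
  assumes "\<And>\<epsilon>. 0 \<le> 2 * \<epsilon> * a + \<epsilon>\<^sup>2 * c"
  shows "a = 0"
proof (rule ccontr)
  assume a: "a \<noteq> 0"
  \<comment> \<open>The step is \<open>- a / d\<close>; this \<open>d\<close> is positive and
    exceeds \<open>c\<close> whatever the sign of \<open>c\<close>.\<close>
  define d where "d = \<bar>c\<bar> + 1"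
  have d: "d > 0" "c < d" by (auto simp: d_def)
  have "0 \<le> 2 * (- a / d) * a + (- a / d)\<^sup>2 * c" by (rule assms)
  also have "\<dots> < 2 * (- a / d) * a + (- a / d)\<^sup>2 * d"
    using a d by (intro add_strict_left_mono mult_strict_left_mono) auto
  also have "\<dots> = - (a\<^sup>2 / d)" using d by (simp add: power2_eq_square field_simps)
  finally show False using d by (simp add: divide_less_0_iff not_less[symmetric])
qed

context reversible_chain
begin

lemma dirichlet_scale: "dirichlet (\<lambda>x. c * f x) = c\<^sup>2 * dirichlet f"
proof -
  have "(c * f x - c * f y)\<^sup>2 = c\<^sup>2 * (f x - f y)\<^sup>2" for x y
    by (simp add: power_mult_distrib[symmetric] right_diff_distrib)
  then show ?thesis by (simp add: dirichlet_def sum_distrib_left mult_ac)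
qed

lemma dirichlet_cong:
  assumes "\<And>x. x \<in> S \<Longrightarrow> f x = g x"
  shows "dirichlet f = dirichlet g"
  unfolding dirichlet_def using assms by simp

text \<open>Compactness of the unit sphere of mean-zero functions. Since functions are defined on
  the whole type, they are set to 0 outside \<open>S\<close> and compactness comes from the product
  topology. Two distinct states ensure that the sphere is nonempty.\<close>

lemma rayleigh_minimizer:
  assumes "a \<in> S" "b \<in> S" "a \<noteq> b"
  obtains f where "(\<Sum>x\<in>S. \<pi> x * f x) = 0" "(\<Sum>x\<in>S. \<pi> x * (f x)\<^sup>2) = 1" "poincare (dirichlet f)"
proof -
  \<comment> \<open>The box loses no normalized function: a unit second moment forces
    \<open>\<pi> x * (f x)\<^sup>2 \<le> 1\<close> at every state. Outside \<open>S\<close> the only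
    allowed value is 0.\<close>
  define Q where "Q = Pi\<^sub>E UNIV (\<lambda>x. if x \<in> S then {- sqrt (1 / \<pi> x)..sqrt (1 / \<pi> x)} else {0})"
  define K where "K = Q \<inter> {f. (\<Sum>x\<in>S. \<pi> x * f x) = 0} \<inter> {f. (\<Sum>x\<in>S. \<pi> x * (f x)\<^sup>2) = 1}"
  have "compactin euclidean Q"
    unfolding Q_def euclidean_product_topology[symmetric] compactin_PiE by auto
  moreover have "closed {f. (\<Sum>x\<in>S. \<pi> x * f x) = 0}" "closed {f. (\<Sum>x\<in>S. \<pi> x * (f x)\<^sup>2) = 1}"
    by (intro closed_Collect_eq continuous_intros continuous_on_product_coordinates)+
  ultimately have compact: "compact K"
    unfolding K_def by (auto intro: compact_Int_closed)
  have normalize: "(\<lambda>x. if x \<in> S then 1 / sqrt N * g x else 0) \<in> K"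
    if g: "(\<Sum>x\<in>S. \<pi> x * g x) = 0" "(\<Sum>x\<in>S. \<pi> x * (g x)\<^sup>2) = N" "N > 0" for g N
  proof -
    have "(\<Sum>x\<in>S. \<pi> x * (1 / sqrt N * g x)) = 1 / sqrt N * (\<Sum>x\<in>S. \<pi> x * g x)"
      unfolding sum_distrib_left by (intro sum.cong) auto
    moreover have "(\<Sum>x\<in>S. \<pi> x * (1 / sqrt N * g x)\<^sup>2) = 1 / N * (\<Sum>x\<in>S. \<pi> x * (g x)\<^sup>2)"
      using g(3) unfolding sum_distrib_left
      by (intro sum.cong) (auto simp: power_mult_distrib power_divide)
    moreover have "1 / sqrt N * g x \<in> {- sqrt (1 / \<pi> x)..sqrt (1 / \<pi> x)}" if "x \<in> S" for x
    proof -
      have "\<pi> x * (g x)\<^sup>2 \<le> N"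
        unfolding g(2)[symmetric] using finite_states that
        by (intro member_le_sum[where f = "\<lambda>x. \<pi> x * (g x)\<^sup>2"]) (auto simp: less_imp_le stat_pos)
      then have "(1 / sqrt N * g x)\<^sup>2 \<le> 1 / \<pi> x"
        using g(3) stat_pos[OF that] by (simp add: power_mult_distrib power_divide field_simps)
      then have "\<bar>1 / sqrt N * g x\<bar> \<le> sqrt (1 / \<pi> x)" by (metis real_sqrt_abs real_sqrt_le_mono)
      then show ?thesis by (simp only: atLeastAtMost_iff abs_le_iff minus_le_iff)
    qed
    ultimately show ?thesis using g by (simp add: K_def Q_def PiE_iff)
  qed
  have "K \<noteq> {}"
  proof -
    \<comment> \<open>Supported on two states, with the weights exchanged so that the mean
      cancels.\<close>
    let ?h = "\<lambda>x. if x = a then \<pi> b else if x = b then - \<pi> a else 0"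
    have split: "(\<Sum>x\<in>S. F x) = F a + F b" if "\<And>x. x \<in> S - {a, b} \<Longrightarrow> F x = 0" for F :: "'s \<Rightarrow> real"
      using sum.mono_neutral_right[of S "{a, b}" F] that assms finite_states by auto
    have "(\<Sum>x\<in>S. \<pi> x * ?h x) = 0" by (subst split) (use assms in auto)
    moreover have "(\<Sum>x\<in>S. \<pi> x * (?h x)\<^sup>2) = \<pi> a * (\<pi> b)\<^sup>2 + \<pi> b * (\<pi> a)\<^sup>2"
      by (subst split) (use assms in auto)
    moreover have "\<dots> > 0" using assms by (intro add_pos_pos mult_pos_pos zero_less_power stat_pos)
    ultimately have "(\<lambda>x. if x \<in> S then 1 / sqrt (\<pi> a * (\<pi> b)\<^sup>2 + \<pi> b * (\<pi> a)\<^sup>2) * ?h x else 0) \<in> K"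
      by (rule normalize)
    then show ?thesis by blast
  qed
  moreover have "continuous_on K dirichlet"
    unfolding dirichlet_def
    by (intro continuous_intros continuous_on_subset[OF continuous_on_product_coordinates]) auto
  ultimately obtain f where f: "f \<in> K" "\<And>g. g \<in> K \<Longrightarrow> dirichlet f \<le> dirichlet g"
    using continuous_attains_inf[OF compact] by blast
  have "poincare (dirichlet f)"
    unfolding poincare_def
  proof (intro allI impI)
    fix g assume g: "(\<Sum>x\<in>S. \<pi> x * g x) = 0"
    define N where "N = (\<Sum>x\<in>S. \<pi> x * (g x)\<^sup>2)"
    have "0 \<le> N" unfolding N_def by (intro sum_nonneg) (simp add: less_imp_le stat_pos)
    moreover have "dirichlet f * N \<le> dirichlet g" if N: "N > 0"
    proof -
      have "dirichlet f \<le> dirichlet (\<lambda>x. if x \<in> S then 1 / sqrt N * g x else 0)"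
        by (rule f(2)[OF normalize[OF g N_def[symmetric] N]])
      also have "\<dots> = dirichlet (\<lambda>x. 1 / sqrt N * g x)" by (rule dirichlet_cong) auto
      also have "\<dots> = dirichlet g / N" unfolding dirichlet_scale using N by (simp add: power_divide)
      finally show ?thesis using N by (simp add: field_simps)
    qed
    ultimately show "dirichlet f * (\<Sum>x\<in>S. \<pi> x * (g x)\<^sup>2) \<le> dirichlet g"
      unfolding N_def[symmetric] using dirichlet_nonneg[of g] by (cases "N = 0") auto
  qed
  with f(1) that show thesis unfolding K_def by auto
qed

lemma dirichlet_add:
  "dirichlet (\<lambda>x. f x + \<epsilon> * h x)
     = dirichlet f - 2 * \<epsilon> * (\<Sum>x\<in>S. \<pi> x * (h x * (\<Sum>y\<in>S. L x y * f y))) + \<epsilon>\<^sup>2 * dirichlet h"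
proof -
  have "(\<Sum>x\<in>S. \<Sum>y\<in>S. \<pi> x * q x y * (f x + \<epsilon> * h x - (f y + \<epsilon> * h y))\<^sup>2)
      = (\<Sum>x\<in>S. \<Sum>y\<in>S. \<pi> x * q x y * (f x - f y)\<^sup>2
          + (2 * \<epsilon> * (\<pi> x * q x y * ((f x - f y) * (h x - h y)))
          + \<epsilon>\<^sup>2 * (\<pi> x * q x y * (h x - h y)\<^sup>2)))"
    by (intro sum.cong refl) (simp add: power2_eq_square algebra_simps)
  then show ?thesis
    unfolding dirichlet_def generator_bilinear
    by (simp add: sum.distrib sum_distrib_left[symmetric])
qed

text \<open>The Euler-Lagrange equation of the minimization, obtained by varying \<open>f\<close> in
  one direction for each state \<open>x\<close>.\<close>

lemma rayleigh_minimizer_eigenfunction: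
  assumes f: "(\<Sum>x\<in>S. \<pi> x * f x) = 0" "(\<Sum>x\<in>S. \<pi> x * (f x)\<^sup>2) = 1" "poincare (dirichlet f)"
    and x: "x \<in> S"
  shows "(\<Sum>y\<in>S. L x y * f y) = - dirichlet f * f x"
proof -
  \<comment> \<open>The indicator of \<open>x\<close>, centered so that the perturbed function keeps
    mean zero. Pairing it with a mean-zero function still extracts the value at
    \<open>x\<close>.\<close>
  define h where "h v = of_bool (v = x) - \<pi> x" for v
  define Lf where "Lf v = (\<Sum>y\<in>S. L v y * f y)" for v
  have pick: "(\<Sum>v\<in>S. \<pi> v * (h v * F v)) = \<pi> x * F x" if "(\<Sum>v\<in>S. \<pi> v * F v) = 0" for F
  proof -
    have "(\<Sum>v\<in>S. \<pi> v * (h v * F v))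
        = (\<Sum>v\<in>S. if v = x then \<pi> v * F v else 0) - \<pi> x * (\<Sum>v\<in>S. \<pi> v * F v)"
      unfolding sum_distrib_left sum_subtractf[symmetric] h_def
      by (intro sum.cong) (auto simp: algebra_simps)
    then show ?thesis using that finite_states x by simp
  qed
  have h0: "(\<Sum>v\<in>S. \<pi> v * h v) = 0"
  proof -
    have "(\<Sum>v\<in>S. \<pi> v * h v) = (\<Sum>v\<in>S. if v = x then \<pi> v else 0) - \<pi> x * (\<Sum>v\<in>S. \<pi> v)"
      unfolding sum_distrib_left sum_subtractf[symmetric] h_def
      by (intro sum.cong) (auto simp: algebra_simps)
    then show ?thesis using finite_states x stat_sum by simp
  qed
  \<comment> \<open>This is the linear coefficient in \<open>\<epsilon>\<close> of the difference of
    the two sides of the Poincare inequality for \<open>f + \<epsilon> h\<close>. The constant term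
    vanishes because \<open>f\<close> attains equality.\<close>
  have "- (\<pi> x * Lf x) - dirichlet f * (\<pi> x * f x) = 0"
  proof (rule quadratic_nonneg_imp_linear_zero)
    fix \<epsilon> :: real
    have "(\<Sum>v\<in>S. \<pi> v * (f v + \<epsilon> * h v)) = 0"
      using f(1) h0 by (simp add: distrib_left sum.distrib mult.left_commute sum_distrib_left[symmetric])
    then have "dirichlet f * (\<Sum>v\<in>S. \<pi> v * (f v + \<epsilon> * h v)\<^sup>2) \<le> dirichlet (\<lambda>v. f v + \<epsilon> * h v)"
      using f(3) unfolding poincare_def by simp
    moreover have "(\<Sum>v\<in>S. \<pi> v * (f v + \<epsilon> * h v)\<^sup>2)
        = (\<Sum>v\<in>S. \<pi> v * (f v)\<^sup>2) + 2 * \<epsilon> * (\<Sum>v\<in>S. \<pi> v * (h v * f v)) + \<epsilon>\<^sup>2 * (\<Sum>v\<in>S. \<pi> v * (h v)\<^sup>2)"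
      unfolding sum_distrib_left sum.distrib[symmetric]
      by (intro sum.cong) (auto simp: power2_eq_square algebra_simps)
    moreover have "(\<Sum>v\<in>S. \<pi> v * (h v * Lf v)) = \<pi> x * Lf x"
      by (rule pick) (simp add: Lf_def generator_stationary)
    ultimately show "0 \<le> 2 * \<epsilon> * (- (\<pi> x * Lf x) - dirichlet f * (\<pi> x * f x))
        + \<epsilon>\<^sup>2 * (dirichlet h - dirichlet f * (\<Sum>v\<in>S. \<pi> v * (h v)\<^sup>2))"
      unfolding dirichlet_add Lf_def[symmetric] using f(2) pick[OF f(1)] by (simp add: algebra_simps)
  qed
  then have "\<pi> x * (Lf x + dirichlet f * f x) = 0" by (simp add: algebra_simps)
  then show ?thesis using stat_pos[OF x] by (simp add: Lf_def)
qed

text \<open>The minimal Rayleigh quotient is positive because a function of zero energy is constant.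
  It is an eigenvalue, and no positive eigenvalue is smaller. Exhibiting the minimum also gives
  meaning to \<open>LEAST\<close> on the reals, where a least element need not exist.\<close>

lemma spectral_gap:
  assumes "a \<in> S" "b \<in> S" "a \<noteq> b"
    and irreducible: "\<And>f x y. dirichlet f = 0 \<Longrightarrow> x \<in> S \<Longrightarrow> y \<in> S \<Longrightarrow> f x = f y"
  obtains \<gamma> f where "0 < \<gamma>" "poincare \<gamma>" "(\<Sum>x\<in>S. \<pi> x * f x) = 0" "(\<Sum>x\<in>S. \<pi> x * (f x)\<^sup>2) = 1"
    "dirichlet f = \<gamma>" "\<And>x. x \<in> S \<Longrightarrow> (\<Sum>y\<in>S. L x y * f y) = - \<gamma> * f x"
    "(LEAST \<theta>. 0 < \<theta> \<and> is_eigenvalue S (\<lambda>x y. - L x y) \<theta>) = \<gamma>"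
proof -
  obtain f where f: "(\<Sum>x\<in>S. \<pi> x * f x) = 0" "(\<Sum>x\<in>S. \<pi> x * (f x)\<^sup>2) = 1" "poincare (dirichlet f)"
    using rayleigh_minimizer[OF assms(1-3)] by blast
  note ef = rayleigh_minimizer_eigenfunction[OF f]
  have nz: "\<exists>x\<in>S. f x \<noteq> 0"
  proof (rule ccontr)
    assume "\<not> ?thesis"
    then have "(\<Sum>x\<in>S. \<pi> x * (f x)\<^sup>2) = 0" by (intro sum.neutral) auto
    then show False using f(2) by simp
  qed
  have pos: "0 < dirichlet f"
  proof (rule ccontr)
    assume "\<not> ?thesis"
    then have "dirichlet f = 0" using dirichlet_nonneg[of f] by simp
    then have c: "f x = f a" if "x \<in> S" for x using irreducible that assms(1) by blast
    then have "(\<Sum>x\<in>S. \<pi> x * f x) = f a"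
      using stat_sum by (simp add: sum_distrib_right[symmetric])
    then show False using nz c f(1) by simp
  qed
  have "(LEAST \<theta>. 0 < \<theta> \<and> is_eigenvalue S (\<lambda>x y. - L x y) \<theta>) = dirichlet f"
  proof (rule Least_equality)
    show "0 < dirichlet f \<and> is_eigenvalue S (\<lambda>x y. - L x y) (dirichlet f)"
      unfolding is_eigenvalue_def using pos nz ef by (intro conjI exI[of _ f]) (auto simp: sum_negf)
  next
    fix \<theta> assume "0 < \<theta> \<and> is_eigenvalue S (\<lambda>x y. - L x y) \<theta>"
    then obtain g where g: "0 < \<theta>" "\<exists>x\<in>S. g x \<noteq> 0" "\<And>x. x \<in> S \<Longrightarrow> (\<Sum>y\<in>S. L x y * g y) = - \<theta> * g x"
      unfolding is_eigenvalue_def by (force simp: sum_negf minus_equation_iff)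
    \<comment> \<open>Stationarity makes the mean of an eigenfunction with nonzero eigenvalue
      vanish, so the Poincare inequality applies to it.\<close>
    have "\<theta> * (\<Sum>x\<in>S. \<pi> x * g x) = 0"
    proof -
      have "(\<Sum>x\<in>S. \<pi> x * (\<Sum>y\<in>S. L x y * g y)) = (\<Sum>x\<in>S. - \<theta> * (\<pi> x * g x))"
        by (intro sum.cong refl) (simp add: g(3))
      then show ?thesis using generator_stationary[of g] by (simp add: sum_negf sum_distrib_left)
    qed
    then have "dirichlet f * (\<Sum>x\<in>S. \<pi> x * (g x)\<^sup>2) \<le> dirichlet g"
      using f(3) g(1) unfolding poincare_def by simp
    also have "dirichlet g = \<theta> * (\<Sum>x\<in>S. \<pi> x * (g x)\<^sup>2)"
    proof -
      have "(\<Sum>x\<in>S. \<pi> x * (g x * (\<Sum>y\<in>S. L x y * g y))) = (\<Sum>x\<in>S. - \<theta> * (\<pi> x * (g x)\<^sup>2))"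
        by (intro sum.cong refl) (simp add: g(3) power2_eq_square)
      then show ?thesis using generator_dirichlet[of g] by (simp add: sum_negf sum_distrib_left)
    qed
    finally have "dirichlet f * (\<Sum>x\<in>S. \<pi> x * (g x)\<^sup>2) \<le> \<theta> * (\<Sum>x\<in>S. \<pi> x * (g x)\<^sup>2)" .
    moreover have "0 < (\<Sum>x\<in>S. \<pi> x * (g x)\<^sup>2)"
    proof -
      obtain x where "x \<in> S" "g x \<noteq> 0" using g(2) by blast
      then show ?thesis using finite_states
        by (intro sum_pos2[of _ x]) (auto simp: stat_pos less_imp_le)
    qed
    ultimately show "dirichlet f \<le> \<theta>" by simp
  qed
  then show thesis using that[OF pos f(3,1,2) refl ef] by blast
qed

lemma eigenfunction_decay:
  assumes "\<And>x. x \<in> S \<Longrightarrow> (\<Sum>y\<in>S. L x y * f y) = - \<gamma> * f x" "x \<in> S"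
  shows "(\<Sum>y\<in>S. P t x y * f y) = exp (- \<gamma> * t) * f x"
proof -
  have "exp (- \<gamma> * t) * f x = (\<Sum>y\<in>S. P t x y * (exp (- \<gamma> * 0) * f y))"
  proof (rule prob_unique[where u = "\<lambda>t x. exp (- \<gamma> * t) * f x", OF _ assms(2)])
    fix t x assume x: "x \<in> S"
    have "(\<Sum>y\<in>S. L x y * (exp (- \<gamma> * t) * f y)) = exp (- \<gamma> * t) * (- \<gamma> * f x)"
      unfolding assms(1)[OF x, symmetric] sum_distrib_left by (intro sum.cong) auto
    then show "((\<lambda>t. exp (- \<gamma> * t) * f x) has_real_derivative
        (\<Sum>y\<in>S. L x y * (exp (- \<gamma> * t) * f y))) (at t)"
      by (auto intro!: derivative_eq_intros)
  qed
  then show ?thesis by simp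
qed

text \<open>The eigenfunction is used as a test function, started at a state where its absolute
  value is maximal; dividing by that maximum removes its size. The 2 undoes the 1/2 in the total
  variation distance.\<close>

lemma tv_dist_lower_bound:
  assumes ef: "\<And>x. x \<in> S \<Longrightarrow> (\<Sum>y\<in>S. L x y * f y) = - \<gamma> * f x"
    and f: "(\<Sum>x\<in>S. \<pi> x * f x) = 0" "(\<Sum>x\<in>S. \<pi> x * (f x)\<^sup>2) = 1"
    and tv: "\<And>x. x \<in> S \<Longrightarrow> tv_dist S (P t x) \<pi> \<le> \<epsilon>"
  shows "exp (- \<gamma> * t) \<le> 2 * \<epsilon>"
proof -
  have ne: "S \<noteq> {}" using stat_sum by auto
  define M where "M = Max ((\<lambda>x. \<bar>f x\<bar>) ` S)"
  have "M \<in> (\<lambda>x. \<bar>f x\<bar>) ` S" unfolding M_def using ne finite_states by (intro Max_in) auto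
  then obtain x where x: "x \<in> S" "\<bar>f x\<bar> = M" by auto
  have M: "\<bar>f y\<bar> \<le> M" if "y \<in> S" for y
    unfolding M_def using that finite_states by (intro Max_ge) auto
  have "M \<noteq> 0"
  proof
    assume "M = 0"
    then have "(\<Sum>x\<in>S. \<pi> x * (f x)\<^sup>2) = 0" using M by (intro sum.neutral) force
    then show False using f(2) by simp
  qed
  then have Mpos: "M > 0" using x by auto
  have "exp (- \<gamma> * t) * M = \<bar>\<Sum>y\<in>S. (P t x y - \<pi> y) * f y\<bar>"
    using eigenfunction_decay[OF ef x(1), of t] f(1) x(2)
    by (simp add: left_diff_distrib sum_subtractf abs_mult)
  also have "\<dots> \<le> (\<Sum>y\<in>S. \<bar>P t x y - \<pi> y\<bar> * M)"
    by (rule order_trans[OF sum_abs]) (auto simp: abs_mult intro!: sum_mono mult_left_mono M)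
  also have "\<dots> = 2 * tv_dist S (P t x) \<pi> * M" by (simp add: tv_dist_def sum_distrib_right)
  also have "\<dots> \<le> 2 * \<epsilon> * M" using tv[OF x(1)] Mpos by simp
  finally show ?thesis using Mpos by simp
qed

end

section \<open>Simple random walk\<close>

locale connected_simple_graph =
  fixes V :: "'a set" and E :: "'a set set"
  assumes simple: "simple_graph V E" and connected: "connected_graph V E" and card_V: "2 \<le> card V"
begin

section \<open>Degrees, edge counts and the stationary law of the walk\<close>

lemma finite_V: "finite V" and edges_subset: "E \<subseteq> {{x, y} | x y. x \<in> V \<and> y \<in> V \<and> x \<noteq> y}"
  using simple by (auto simp: simple_graph_def)

lemma finite_E: "finite E"
proof (rule finite_subset)
  show "E \<subseteq> Pow V" using edges_subset by auto
qed (simp add: finite_V)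

lemma edgeE:
  assumes "e \<in> E"
  obtains x y where "e = {x, y}" "x \<in> V" "y \<in> V" "x \<noteq> y"
  using assms edges_subset by blast

lemma edge_in_V: "{x, y} \<in> E \<Longrightarrow> x \<in> V \<and> y \<in> V \<and> x \<noteq> y"
  using edges_subset by (fastforce simp: doubleton_eq_iff)

lemma nbrs_eq: "nbrs V E x = {y. {x, y} \<in> E}"
  using edge_in_V by (auto simp: nbrs_def)

lemma finite_nbrs: "finite (nbrs V E x)"
  using finite_V by (simp add: nbrs_def)

lemma deg_pos:
  assumes "x \<in> V"
  shows "0 < deg V E x"
proof -
  obtain y where y: "y \<in> V" "y \<noteq> x"
  proof -
    have "\<not> V \<subseteq> {x}" using card_V card_mono[of "{x}" V] by auto
    then show thesis using that by blast
  qed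
  have "(x, y) \<in> {(u, v). {u, v} \<in> E}\<^sup>*" using connected assms y(1) by (simp add: connected_graph_def)
  then obtain z where "{x, z} \<in> E" using y(2) by (cases rule: converse_rtranclE) auto
  then have "nbrs V E x \<noteq> {}" by (auto simp: nbrs_eq)
  then show ?thesis using finite_nbrs by (simp add: deg_def card_gt_0_iff)
qed

lemma handshake: "(\<Sum>x\<in>V. deg V E x) = 2 * card E"
proof -
  have "deg V E x = (\<Sum>e\<in>E. of_bool (x \<in> e))" for x
  proof -
    have "bij_betw (\<lambda>y. {x, y}) (nbrs V E x) {e \<in> E. x \<in> e}"
    proof (rule bij_betw_imageI)
      show "inj_on (\<lambda>y. {x, y}) (nbrs V E x)" by (auto simp: inj_on_def doubleton_eq_iff)
      show "(\<lambda>y. {x, y}) ` nbrs V E x = {e \<in> E. x \<in> e}"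
      proof (intro equalityI subsetI)
        fix e assume "e \<in> {e \<in> E. x \<in> e}"
        then have e: "e \<in> E" "x \<in> e" by auto
        from e(1) obtain u v where "e = {u, v}" by (rule edgeE)
        then have "e = {x, u} \<or> e = {x, v}" using e(2) by auto
        then show "e \<in> (\<lambda>y. {x, y}) ` nbrs V E x" using e(1) by (auto simp: nbrs_eq)
      qed (auto simp: nbrs_eq)
    qed
    then have "deg V E x = card {e \<in> E. x \<in> e}" unfolding deg_def by (rule bij_betw_same_card)
    then show ?thesis using finite_E by (simp add: of_bool_def sum.If_cases Int_def)
  qed
  then have "(\<Sum>x\<in>V. deg V E x) = (\<Sum>e\<in>E. \<Sum>x\<in>V. of_bool (x \<in> e))" by (simp, intro sum.swap)
  also have "\<dots> = (\<Sum>e\<in>E. 2)"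
  proof (rule sum.cong[OF refl])
    fix e assume "e \<in> E"
    then obtain x y where e: "e = {x, y}" "x \<in> V" "y \<in> V" "x \<noteq> y" by (rule edgeE)
    have "(\<Sum>v\<in>V. of_bool (v \<in> e) :: nat) = card (V \<inter> e)"
      using finite_V by (simp add: of_bool_def sum.If_cases Int_def)
    also have "V \<inter> e = {x, y}" using e by auto
    finally show "(\<Sum>v\<in>V. of_bool (v \<in> e)) = (2::nat)" using e by simp
  qed
  finally show ?thesis by simp
qed

lemma V_nonempty: "V \<noteq> {}"
  using card_V by auto

lemma card_E_pos: "0 < card E"
proof -
  have "0 < (\<Sum>x\<in>V. deg V E x)" using deg_pos finite_V V_nonempty by (intro sum_pos) auto
  then show ?thesis using handshake by simp
qed

lemma card_E_le: "2 * card E \<le> (card V)\<^sup>2"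
proof -
  have "(\<Sum>x\<in>V. deg V E x) \<le> (\<Sum>x\<in>V. card V)"
    by (intro sum_mono) (auto simp: deg_def nbrs_def intro: card_mono finite_V)
  then show ?thesis by (simp add: handshake power2_eq_square)
qed

lemma srw_stat_pos: "x \<in> V \<Longrightarrow> 0 < srw_stat V E x"
  using deg_pos card_E_pos by (simp add: srw_stat_def)

lemma srw_stat_sum: "sum (srw_stat V E) V = 1"
proof -
  have "real (\<Sum>x\<in>V. deg V E x) = 2 * real (card E)" by (simp add: handshake)
  then show ?thesis
    using card_E_pos by (simp add: srw_stat_def sum_divide_distrib[symmetric])
qed

text \<open>Degrees are at least 1 and \<open>2 * card E\<close> is at most the square of
  \<open>card V\<close>. This polynomial bound is why the cost of an arbitrary starting vertex is of
  order \<open>log |V|\<close> relaxation times.\<close>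

lemma inverse_srw_stat_le:
  assumes "x \<in> V"
  shows "1 / srw_stat V E x \<le> (real (card V))\<^sup>2"
proof -
  have "1 / srw_stat V E x = real (2 * card E) / real (deg V E x)" by (simp add: srw_stat_def)
  also have "\<dots> \<le> real (2 * card E)" using deg_pos[OF assms]
    by (simp add: field_simps mult_le_cancel_left1 Suc_le_eq)
  also have "\<dots> \<le> real ((card V)\<^sup>2)" using card_E_le by (simp only: of_nat_le_iff)
  finally show ?thesis by simp
qed

lemma srw_row_sum:
  assumes "x \<in> V"
  shows "(\<Sum>y\<in>V. srw_matrix V E x y) = 1"
proof -
  have "(\<Sum>y\<in>V. of_bool ({x, y} \<in> E) :: real) = real (deg V E x)"
    using finite_V by (simp add: of_bool_def sum.If_cases Int_def deg_def nbrs_def)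
  then show ?thesis using deg_pos[OF assms] by (simp add: srw_matrix_def sum_divide_distrib[symmetric])
qed

text \<open>Every edge has the same conductance, which makes reversibility immediate.\<close>

lemma srw_stat_rate:
  assumes "x \<in> V"
  shows "srw_stat V E x * srw_matrix V E x y = of_bool ({x, y} \<in> E) / (2 * real (card E))"
  using deg_pos[OF assms] by (simp add: srw_stat_def srw_matrix_def)

sublocale srw: reversible_chain V "srw_matrix V E" "srw_stat V E"
proof
  show "srw_stat V E x * srw_matrix V E x y = srw_stat V E y * srw_matrix V E y x"
    if "x \<in> V" "y \<in> V" for x y
    using that by (simp add: srw_stat_rate insert_commute)
qed (auto simp: finite_V srw_stat_pos srw_stat_sum srw_matrix_def)

lemma srw_irreducible:
  assumes "srw.dirichlet f = 0" "x \<in> V" "y \<in> V"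
  shows "f x = f y"
proof -
  have nn: "0 \<le> srw_stat V E x * srw_matrix V E x y * (f x - f y)\<^sup>2" if "x \<in> V" for x y
    by (simp add: srw_stat_rate[OF that])
  have zero: "(\<Sum>x\<in>V. \<Sum>y\<in>V. srw_stat V E x * srw_matrix V E x y * (f x - f y)\<^sup>2) = 0"
    using assms(1) by (simp add: srw.dirichlet_def)
  have step: "f u = f v" if "{u, v} \<in> E" for u v
  proof -
    have uv: "u \<in> V" "v \<in> V" using edge_in_V[OF that] by auto
    have "srw_stat V E u * srw_matrix V E u v * (f u - f v)\<^sup>2 = 0"
      using zero uv nn finite_V by (auto simp: sum_nonneg_eq_0_iff sum_nonneg)
    then show ?thesis using that card_E_pos by (simp add: srw_stat_rate[OF uv(1)])
  qed
  have "(x, y) \<in> {(u, v). {u, v} \<in> E}\<^sup>*" using connected assms by (simp add: connected_graph_def)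
  then show ?thesis by (induction rule: rtrancl_induct) (auto dest: step)
qed

section \<open>Relaxation time and total variation mixing of the static walk\<close>

lemma srw_generator: "x \<in> V \<Longrightarrow> ctmc_generator V (srw_matrix V E) x y = srw_matrix V E x y - of_bool (x = y)"
  by (cases "x = y") (simp_all add: ctmc_generator_def srw_row_sum)

text \<open>The spectrum of I - P is at most 2, from
  \<open>(a - b)\<^sup>2 \<le> 2 * a\<^sup>2 + 2 * b\<^sup>2\<close> and reversibility. It serves to
  bound the relaxation time below by 1/2.\<close>

lemma srw_dirichlet_le: "srw.dirichlet f \<le> 2 * (\<Sum>x\<in>V. srw_stat V E x * (f x)\<^sup>2)"
proof -
  let ?\<pi> = "srw_stat V E" and ?p = "srw_matrix V E"
  have "(\<Sum>x\<in>V. \<Sum>y\<in>V. ?\<pi> x * ?p x y * (f x - f y)\<^sup>2)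
      \<le> (\<Sum>x\<in>V. \<Sum>y\<in>V. 2 * (?\<pi> x * ?p x y * (f x)\<^sup>2) + 2 * (?\<pi> x * ?p x y * (f y)\<^sup>2))"
  proof (intro sum_mono)
    fix x y assume "x \<in> V" "y \<in> V"
    then have "0 \<le> ?\<pi> x * ?p x y" by (simp add: srw_stat_rate)
    moreover have "(f x - f y)\<^sup>2 \<le> 2 * (f x)\<^sup>2 + 2 * (f y)\<^sup>2"
      using zero_le_power2[of "f x + f y"] by (simp add: power2_eq_square algebra_simps)
    ultimately have "?\<pi> x * ?p x y * (f x - f y)\<^sup>2 \<le> ?\<pi> x * ?p x y * (2 * (f x)\<^sup>2 + 2 * (f y)\<^sup>2)"
      by (rule mult_left_mono[rotated])
    then show "?\<pi> x * ?p x y * (f x - f y)\<^sup>2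
        \<le> 2 * (?\<pi> x * ?p x y * (f x)\<^sup>2) + 2 * (?\<pi> x * ?p x y * (f y)\<^sup>2)"
      by (simp add: algebra_simps)
  qed
  also have "\<dots> = 2 * (\<Sum>x\<in>V. \<Sum>y\<in>V. ?\<pi> x * ?p x y * (f x)\<^sup>2)
      + 2 * (\<Sum>y\<in>V. \<Sum>x\<in>V. ?\<pi> x * ?p x y * (f y)\<^sup>2)"
    by (simp add: sum.distrib sum_distrib_left) (rule sum.swap)
  also have "(\<Sum>y\<in>V. \<Sum>x\<in>V. ?\<pi> x * ?p x y * (f y)\<^sup>2) = (\<Sum>y\<in>V. \<Sum>x\<in>V. ?\<pi> y * ?p y x * (f y)\<^sup>2)"
    by (intro sum.cong refl) (simp add: srw.balance)
  also have "(\<Sum>x\<in>V. \<Sum>y\<in>V. ?\<pi> x * ?p x y * (f x)\<^sup>2) = (\<Sum>x\<in>V. ?\<pi> x * (f x)\<^sup>2)"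
  proof (rule sum.cong[OF refl])
    fix x assume "x \<in> V"
    have "(\<Sum>y\<in>V. ?\<pi> x * ?p x y * (f x)\<^sup>2) = ?\<pi> x * (f x)\<^sup>2 * (\<Sum>y\<in>V. ?p x y)"
      unfolding sum_distrib_left by (intro sum.cong) auto
    then show "(\<Sum>y\<in>V. ?\<pi> x * ?p x y * (f x)\<^sup>2) = ?\<pi> x * (f x)\<^sup>2"
      using srw_row_sum[OF \<open>x \<in> V\<close>] by simp
  qed
  finally show ?thesis by (simp add: srw.dirichlet_def)
qed

text \<open>The three facts are proved together because they come from one and the same
  eigenfunction of the spectral gap.\<close>

lemma srw_spectral:
  shows srw_rel_time_ge: "1 / 2 \<le> srw_rel_time V E"
    and srw_poincare: "srw.poincare (1 / srw_rel_time V E)"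
    and srw_tv_lower: "(\<And>x. x \<in> V \<Longrightarrow> tv_dist V (srw.P t x) (srw_stat V E) \<le> \<epsilon>)
      \<Longrightarrow> exp (- (t / srw_rel_time V E)) \<le> 2 * \<epsilon>"
proof -
  obtain e where "e \<in> E" using card_E_pos by fastforce
  then obtain a b where ab: "a \<in> V" "b \<in> V" "a \<noteq> b" by (rule edgeE)
  obtain \<gamma> f where g: "0 < \<gamma>" "srw.poincare \<gamma>" "(\<Sum>x\<in>V. srw_stat V E x * f x) = 0"
    "(\<Sum>x\<in>V. srw_stat V E x * (f x)\<^sup>2) = 1" "srw.dirichlet f = \<gamma>"
    "\<And>x. x \<in> V \<Longrightarrow> (\<Sum>y\<in>V. srw.L x y * f y) = - \<gamma> * f x"
    "(LEAST \<theta>. 0 < \<theta> \<and> is_eigenvalue V (\<lambda>x y. - srw.L x y) \<theta>) = \<gamma>"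
    using srw.spectral_gap[OF ab srw_irreducible] by blast
  \<comment> \<open>The rows of the walk matrix sum to 1, so minus the generator is the matrix I - P
    of the definition of the relaxation time.\<close>
  have "is_eigenvalue V (\<lambda>x y. - srw.L x y) \<theta>
      \<longleftrightarrow> is_eigenvalue V (\<lambda>x y. of_bool (x = y) - srw_matrix V E x y) \<theta>" for \<theta>
    unfolding is_eigenvalue_def by (simp add: srw_generator)
  then have rel: "srw_rel_time V E = 1 / \<gamma>" using g(7) by (simp add: srw_rel_time_def)
  have "\<gamma> \<le> 2" using srw_dirichlet_le[of f] g by simp
  then show "1 / 2 \<le> srw_rel_time V E" using g(1) unfolding rel by (intro divide_left_mono) auto
  show "srw.poincare (1 / srw_rel_time V E)" using g(2) rel by simp
  show "exp (- (t / srw_rel_time V E)) \<le> 2 * \<epsilon>"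
    if "\<And>x. x \<in> V \<Longrightarrow> tv_dist V (srw.P t x) (srw_stat V E) \<le> \<epsilon>"
    using srw.tv_dist_lower_bound[OF g(6) g(3,4) that] rel by (simp add: mult.commute)
qed

lemma srw_tv_mixing_time_nonneg: "0 \<le> srw_tv_mixing_time V E \<epsilon>"
  unfolding srw_tv_mixing_time_def tv_mixing_time_def by (rule Inf_greatest) auto

lemma srw_tv_mixing_time_upper:
  "srw_tv_mixing_time V E (1 / real (card V)) \<le> ereal (3 * (srw_rel_time V E * ln (real (card V))))"
proof -
  define n where "n = real (card V)"
  \<comment> \<open>Three factors \<open>1 / n\<close> from the decay: two cancel the initial
    density bound \<open>n\<^sup>2\<close>, and one remains as the target.\<close>
  define s where "s = 3 * (srw_rel_time V E * ln n)"
  let ?\<pi> = "srw_stat V E"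
  have n: "n \<ge> 2" using card_V by (simp add: n_def)
  have rel: "srw_rel_time V E > 0" using srw_rel_time_ge by simp
  have s: "0 \<le> s" using n rel by (simp add: s_def)
  have exps: "exp (- (1 / srw_rel_time V E) * s) = 1 / n ^ 3"
  proof -
    have "exp (- (1 / srw_rel_time V E) * s) = exp (- (real 3 * ln n))" using rel by (simp add: s_def)
    also have "\<dots> = 1 / n ^ 3" using n by (subst exp_minus, subst exp_of_nat_mult) (simp add: divide_simps)
    finally show ?thesis .
  qed
  have dens: "\<bar>srw.P s x y / ?\<pi> y - 1\<bar> \<le> 1 / n" if xy: "x \<in> V" "y \<in> V" for x y
  proof -
    have "\<bar>srw.P s x y / ?\<pi> y - 1\<bar> \<le> exp (- (1 / srw_rel_time V E) * s) * sqrt (1 / ?\<pi> x * (1 / ?\<pi> y))"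
      using srw.density_bound[OF srw_poincare xy s, of 0] by (simp add: srw.prob_0)
    also have "sqrt (1 / ?\<pi> x * (1 / ?\<pi> y)) \<le> sqrt (n\<^sup>2 * n\<^sup>2)"
      using xy inverse_srw_stat_le srw_stat_pos unfolding n_def
      by (intro real_sqrt_le_mono mult_mono) (auto simp: less_imp_le)
    also have "\<dots> = n\<^sup>2" by (simp only: real_sqrt_abs2 abs_power2)
    also have "exp (- (1 / srw_rel_time V E) * s) * n\<^sup>2 = 1 / n"
      unfolding exps using n by (simp add: power2_eq_square power3_eq_cube)
    finally show ?thesis by (simp add: mult_left_mono)
  qed
  have "tv_dist V (srw.P s x) ?\<pi> \<le> 1 / n" if x: "x \<in> V" for x
  proof -
    have "(\<Sum>y\<in>V. \<bar>srw.P s x y - ?\<pi> y\<bar>) \<le> (\<Sum>y\<in>V. ?\<pi> y * (1 / n))"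
    proof (rule sum_mono)
      fix y assume y: "y \<in> V"
      have "srw.P s x y - ?\<pi> y = ?\<pi> y * (srw.P s x y / ?\<pi> y - 1)"
        using srw_stat_pos[OF y] by (simp add: right_diff_distrib)
      then have "\<bar>srw.P s x y - ?\<pi> y\<bar> = ?\<pi> y * \<bar>srw.P s x y / ?\<pi> y - 1\<bar>"
        using srw_stat_pos[OF y] by (simp only: abs_mult abs_of_pos)
      also have "\<dots> \<le> ?\<pi> y * (1 / n)" using dens[OF x y] srw_stat_pos[OF y] by (intro mult_left_mono) auto
      finally show "\<bar>srw.P s x y - ?\<pi> y\<bar> \<le> ?\<pi> y * (1 / n)" .
    qed
    also have "\<dots> = 1 / n" using srw_stat_sum by (simp add: sum_divide_distrib[symmetric])
    finally have "tv_dist V (srw.P s x) ?\<pi> \<le> (1 / 2) * (1 / n)" unfolding tv_dist_def by simp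
    also have "\<dots> \<le> 1 / n" using n by (simp add: field_simps)
    finally show ?thesis .
  qed
  then show ?thesis
    unfolding srw_tv_mixing_time_def tv_mixing_time_def n_def[symmetric] s_def[symmetric]
    using s by (intro Inf_lower) auto
qed

text \<open>The eigenfunction bound reads \<open>exp (- (t / srw_rel_time V E)) \<le> 2 / n\<close>,
  which carries no information for \<open>n = 2\<close>; this is where three vertices are
  required.\<close>

lemma srw_tv_mixing_time_lower:
  assumes "3 \<le> card V"
  shows "ereal (srw_rel_time V E * ln (real (card V)) / 3) \<le> srw_tv_mixing_time V E (1 / real (card V))"
  unfolding srw_tv_mixing_time_def tv_mixing_time_def
proof (rule Inf_greatest)
  define n where "n = real (card V)"
  have n: "n \<ge> 3" using assms by (simp add: n_def)
  fix T assume "T \<in> {ereal t |t. 0 \<le> t \<and> (\<forall>x\<in>V. tv_dist V (srw.P t x) (srw_stat V E) \<le> 1 / real (card V))}"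
  then obtain t where t: "T = ereal t" "\<And>x. x \<in> V \<Longrightarrow> tv_dist V (srw.P t x) (srw_stat V E) \<le> 1 / n"
    unfolding n_def by blast
  have "exp (- (t / srw_rel_time V E)) \<le> 2 / n" using srw_tv_lower[OF t(2)] by simp
  then have "- (t / srw_rel_time V E) \<le> ln (2 / n)" using n by (simp add: ln_ge_iff)
  then have "ln n - ln 2 \<le> t / srw_rel_time V E" using n by (simp add: ln_div)
  \<comment> \<open>For \<open>n \<ge> 3\<close> this follows from 8 < 9, that is
    \<open>2 ^ 3 \<le> 3 ^ 2\<close>; a third of \<open>ln n\<close> is then left over.\<close>
  moreover have "ln 2 \<le> 2 / 3 * ln n"
  proof -
    have "(3::real) ^ 2 \<le> n ^ 2" using n by (intro power_mono) auto
    then have "(2::real) ^ 3 \<le> n ^ 2" by simp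
    then have "ln ((2::real) ^ 3) \<le> ln (n ^ 2)" using n by (subst ln_le_cancel_iff) auto
    also have "ln ((2::real) ^ 3) = 3 * ln 2" by (subst ln_realpow) auto
    also have "ln (n ^ 2) = 2 * ln n" using n by (subst ln_realpow) auto
    finally show ?thesis by simp
  qed
  ultimately have "ln n / 3 \<le> t / srw_rel_time V E" by linarith
  then have "srw_rel_time V E * ln n / 3 \<le> t" using srw_rel_time_ge by (simp add: field_simps)
  then show "ereal (srw_rel_time V E * ln (real (card V)) / 3) \<le> T" by (simp add: t(1) n_def)
qed

end

section \<open>Bernoulli environments\<close>

definition bernoulli_mean :: "'e set \<Rightarrow> real \<Rightarrow> ('e set \<Rightarrow> real) \<Rightarrow> real" where
  "bernoulli_mean E p f = (\<Sum>\<eta>\<in>Pow E. (\<Prod>e\<in>E. if e \<in> \<eta> then p else 1 - p) * f \<eta>)"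

text \<open>The discrete derivative in the coordinate \<open>e\<close>. Inserting and removing
  \<open>e\<close> makes it independent of the state of \<open>e\<close> itself, so its mean is the
  same over \<open>E\<close> and over \<open>E - {e}\<close>.\<close>

definition flip_diff :: "'e \<Rightarrow> ('e set \<Rightarrow> real) \<Rightarrow> 'e set \<Rightarrow> real" where
  "flip_diff e f \<eta> = f (insert e \<eta>) - f (\<eta> - {e})"

lemma bernoulli_mean_empty: "bernoulli_mean {} p f = f {}"
  by (simp add: bernoulli_mean_def)

section \<open>Calculus of Bernoulli expectations\<close>

lemma bernoulli_mean_cong:
  assumes "\<And>\<eta>. \<eta> \<subseteq> E \<Longrightarrow> f \<eta> = g \<eta>"
  shows "bernoulli_mean E p f = bernoulli_mean E p g"
  unfolding bernoulli_mean_def using assms by (intro sum.cong) auto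

lemma bernoulli_mean_add: "bernoulli_mean E p (\<lambda>\<eta>. f \<eta> + g \<eta>) = bernoulli_mean E p f + bernoulli_mean E p g"
  by (simp add: bernoulli_mean_def distrib_left sum.distrib)

lemma bernoulli_mean_diff: "bernoulli_mean E p (\<lambda>\<eta>. f \<eta> - g \<eta>) = bernoulli_mean E p f - bernoulli_mean E p g"
  by (simp add: bernoulli_mean_def right_diff_distrib sum_subtractf)

lemma bernoulli_mean_cmult: "bernoulli_mean E p (\<lambda>\<eta>. c * f \<eta>) = c * bernoulli_mean E p f"
  by (simp add: bernoulli_mean_def sum_distrib_left mult.left_commute)

lemma bernoulli_mean_sum: "bernoulli_mean E p (\<lambda>\<eta>. \<Sum>i\<in>I. f i \<eta>) = (\<Sum>i\<in>I. bernoulli_mean E p (f i))"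
  unfolding bernoulli_mean_def sum_distrib_left by (rule sum.swap)

lemma bernoulli_mean_nonneg:
  assumes "0 \<le> p" "p \<le> 1" "\<And>\<eta>. 0 \<le> f \<eta>"
  shows "0 \<le> bernoulli_mean E p f"
  unfolding bernoulli_mean_def using assms by (intro sum_nonneg mult_nonneg_nonneg prod_nonneg) auto

text \<open>Conditioning on the state of one edge, written as a recursion over the index set. In the
  second term the configurations are subsets of \<open>E\<close>, so \<open>e\<close> is
  closed.\<close>

lemma bernoulli_mean_insert:
  assumes "finite E" "e \<notin> E"
  shows "bernoulli_mean (insert e E) p f
    = p * bernoulli_mean E p (\<lambda>\<eta>. f (insert e \<eta>)) + (1 - p) * bernoulli_mean E p f"
proof -
  let ?w = "\<lambda>E \<eta>. \<Prod>e\<in>E. if e \<in> \<eta> then p else 1 - p"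
  have inj: "inj_on (insert e) (Pow E)" using assms(2) by (auto simp: inj_on_def)
  have w: "?w (insert e E) (insert e \<eta>) = p * ?w E \<eta>" "?w (insert e E) \<eta> = (1 - p) * ?w E \<eta>"
    if "\<eta> \<subseteq> E" for \<eta>
  proof -
    have "(\<Prod>x\<in>E. if x \<in> insert e \<eta> then p else 1 - p) = ?w E \<eta>"
      using assms(2) by (intro prod.cong) auto
    then show "?w (insert e E) (insert e \<eta>) = p * ?w E \<eta>" using assms by simp
    show "?w (insert e E) \<eta> = (1 - p) * ?w E \<eta>" using assms that by auto
  qed
  have "bernoulli_mean (insert e E) p f
      = (\<Sum>\<eta>\<in>Pow E. ?w (insert e E) \<eta> * f \<eta>) + (\<Sum>\<eta>\<in>insert e ` Pow E. ?w (insert e E) \<eta> * f \<eta>)"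
    unfolding bernoulli_mean_def Pow_insert using assms by (intro sum.union_disjoint) auto
  also have "(\<Sum>\<eta>\<in>insert e ` Pow E. ?w (insert e E) \<eta> * f \<eta>)
      = (\<Sum>\<eta>\<in>Pow E. ?w (insert e E) (insert e \<eta>) * f (insert e \<eta>))"
    by (subst sum.reindex[OF inj]) simp
  also have "\<dots> = (\<Sum>\<eta>\<in>Pow E. p * (?w E \<eta> * f (insert e \<eta>)))"
    by (intro sum.cong refl) (simp only: Pow_iff w mult.assoc)
  also have "(\<Sum>\<eta>\<in>Pow E. ?w (insert e E) \<eta> * f \<eta>) = (\<Sum>\<eta>\<in>Pow E. (1 - p) * (?w E \<eta> * f \<eta>))"
    by (intro sum.cong refl) (simp only: Pow_iff w mult.assoc)
  finally show ?thesis by (simp add: bernoulli_mean_def sum_distrib_left)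
qed

lemma bernoulli_mean_remove:
  assumes "finite E" "e \<in> E"
  shows "bernoulli_mean E p f = p * bernoulli_mean (E - {e}) p (\<lambda>\<eta>. f (insert e \<eta>))
    + (1 - p) * bernoulli_mean (E - {e}) p f"
  using bernoulli_mean_insert[of "E - {e}" e p f] assms by (simp add: insert_absorb)

lemma bernoulli_mean_const: "finite E \<Longrightarrow> bernoulli_mean E p (\<lambda>_. c) = c"
  by (induction E rule: finite_induct)
     (simp_all add: bernoulli_mean_empty bernoulli_mean_insert left_diff_distrib)

lemma bernoulli_mean_independent:
  assumes "finite E" "e \<in> E" "\<And>\<eta>. g (insert e \<eta>) = g \<eta>"
  shows "bernoulli_mean (E - {e}) p g = bernoulli_mean E p g"
  using bernoulli_mean_remove[OF assms(1,2), of p g] assms(3) by (simp add: left_diff_distrib)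

lemma flip_diff_insert: "flip_diff e f (insert e \<eta>) = flip_diff e f \<eta>"
  by (simp add: flip_diff_def)

lemma bernoulli_mean_jensen:
  assumes "finite E" "0 \<le> p" "p \<le> 1"
  shows "(bernoulli_mean E p f)\<^sup>2 \<le> bernoulli_mean E p (\<lambda>\<eta>. (f \<eta>)\<^sup>2)"
proof -
  define m where "m = bernoulli_mean E p f"
  have "0 \<le> bernoulli_mean E p (\<lambda>\<eta>. (f \<eta> - m)\<^sup>2)" by (intro bernoulli_mean_nonneg assms) auto
  also have "\<dots> = bernoulli_mean E p (\<lambda>\<eta>. (f \<eta>)\<^sup>2 - 2 * m * f \<eta> + m\<^sup>2)"
    by (simp add: power2_diff algebra_simps)
  also have "\<dots> = bernoulli_mean E p (\<lambda>\<eta>. (f \<eta>)\<^sup>2) - 2 * m * m + m\<^sup>2"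
    by (simp add: bernoulli_mean_add bernoulli_mean_diff bernoulli_mean_cmult
        bernoulli_mean_const[OF assms(1)] m_def)
  finally show ?thesis unfolding m_def[symmetric] by (simp add: power2_eq_square)
qed

text \<open>The covariance of \<open>f\<close> with the indicator that \<open>e\<close> is open is
  the variance of that indicator times the mean discrete derivative.\<close>

lemma bernoulli_covariance:
  assumes "finite E" "e \<in> E"
  shows "bernoulli_mean E p (\<lambda>\<eta>. of_bool (e \<in> \<eta>) * f \<eta>)
    = p * bernoulli_mean E p f + p * (1 - p) * bernoulli_mean E p (flip_diff e f)"
proof -
  let ?M = "bernoulli_mean (E - {e}) p"
  have "bernoulli_mean E p (flip_diff e f) = ?M (flip_diff e f)"
    by (rule bernoulli_mean_independent[OF assms, symmetric]) (rule flip_diff_insert)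
  also have "\<dots> = ?M (\<lambda>\<eta>. f (insert e \<eta>) - f \<eta>)"
    by (intro bernoulli_mean_cong) (simp add: flip_diff_def Diff_insert0 subset_Diff_insert)
  also have "\<dots> = ?M (\<lambda>\<eta>. f (insert e \<eta>)) - ?M f" by (rule bernoulli_mean_diff)
  finally have d: "bernoulli_mean E p (flip_diff e f) = \<dots>" .
  have "?M (\<lambda>\<eta>. of_bool (e \<in> \<eta>) * f \<eta>) = ?M (\<lambda>_. 0)"
    by (intro bernoulli_mean_cong) auto
  then have z: "?M (\<lambda>\<eta>. of_bool (e \<in> \<eta>) * f \<eta>) = 0" by (simp add: bernoulli_mean_def)
  show ?thesis
    by (subst (1 2) bernoulli_mean_remove[OF assms]) (simp only: d z, simp add: algebra_simps)
qed

text \<open>The left side is the mean squared change of \<open>f\<close> when \<open>e\<close> is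
  refreshed. The state changes from open to closed or from closed to open, each with probability
  \<open>p * (1 - p)\<close>; hence the factor 2.\<close>

lemma bernoulli_resample_energy:
  assumes "finite E" "e \<in> E"
  shows "bernoulli_mean E p (\<lambda>\<eta>. p * (f \<eta> - f (insert e \<eta>))\<^sup>2 + (1 - p) * (f \<eta> - f (\<eta> - {e}))\<^sup>2)
    = 2 * (p * (1 - p) * bernoulli_mean E p (\<lambda>\<eta>. (flip_diff e f \<eta>)\<^sup>2))"
proof -
  let ?M = "bernoulli_mean (E - {e}) p"
  have a: "?M (\<lambda>\<eta>. p * (f (insert e \<eta>) - f (insert e (insert e \<eta>)))\<^sup>2
      + (1 - p) * (f (insert e \<eta>) - f (insert e \<eta> - {e}))\<^sup>2)
      = ?M (\<lambda>\<eta>. (1 - p) * (flip_diff e f \<eta>)\<^sup>2)"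
    by (intro bernoulli_mean_cong) (simp add: flip_diff_def)
  have b: "?M (\<lambda>\<eta>. p * (f \<eta> - f (insert e \<eta>))\<^sup>2 + (1 - p) * (f \<eta> - f (\<eta> - {e}))\<^sup>2)
      = ?M (\<lambda>\<eta>. p * (flip_diff e f \<eta>)\<^sup>2)"
    by (intro bernoulli_mean_cong) (simp add: flip_diff_def power2_commute subset_Diff_insert Diff_insert0)
  have c: "?M (\<lambda>\<eta>. (flip_diff e f \<eta>)\<^sup>2) = bernoulli_mean E p (\<lambda>\<eta>. (flip_diff e f \<eta>)\<^sup>2)"
    by (rule bernoulli_mean_independent[OF assms]) (simp add: flip_diff_insert)
  show ?thesis
    by (subst bernoulli_mean_remove[OF assms])
       (simp only: a b bernoulli_mean_cmult c, simp add: algebra_simps)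
qed

text \<open>Induction on the edge set: conditioning on the new edge splits the variance into the
  mean of two conditional variances and \<open>p * (1 - p)\<close> times the squared difference of
  the conditional means. Jensen bounds the latter by the energy of the new edge.\<close>

lemma bernoulli_efron_stein:
  assumes "finite E" "0 \<le> p" "p \<le> 1"
  shows "bernoulli_mean E p (\<lambda>\<eta>. (f \<eta>)\<^sup>2) - (bernoulli_mean E p f)\<^sup>2
    \<le> (\<Sum>e\<in>E. p * (1 - p) * bernoulli_mean E p (\<lambda>\<eta>. (flip_diff e f \<eta>)\<^sup>2))"
  using assms(1)
proof (induction E arbitrary: f rule: finite_induct)
  case empty
  then show ?case by (simp add: bernoulli_mean_empty)
next
  case (insert e E)
  let ?M = "bernoulli_mean E p" and ?g = "\<lambda>\<eta>. f (insert e \<eta>)"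
  let ?V = "\<lambda>e' f. p * (1 - p) * bernoulli_mean E p (\<lambda>\<eta>. (flip_diff e' f \<eta>)\<^sup>2)"
  have old: "p * (1 - p) * bernoulli_mean (insert e E) p (\<lambda>\<eta>. (flip_diff e' f \<eta>)\<^sup>2)
      = p * ?V e' ?g + (1 - p) * ?V e' f" if "e' \<in> E" for e'
  proof -
    have "flip_diff e' f (insert e \<eta>) = flip_diff e' ?g \<eta>" for \<eta>
      using that insert.hyps(2) by (auto simp: flip_diff_def insert_commute insert_Diff_if)
    then show ?thesis
      by (simp add: bernoulli_mean_insert[OF insert.hyps] algebra_simps)
  qed
  have new: "bernoulli_mean (insert e E) p (\<lambda>\<eta>. (flip_diff e f \<eta>)\<^sup>2) = ?M (\<lambda>\<eta>. (?g \<eta> - f \<eta>)\<^sup>2)"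
  proof -
    have "?M (\<lambda>\<eta>. (flip_diff e f \<eta>)\<^sup>2) = ?M (\<lambda>\<eta>. (?g \<eta> - f \<eta>)\<^sup>2)"
      using insert.hyps(2) by (intro bernoulli_mean_cong) (simp add: flip_diff_def subset_eq Diff_insert0, metis Diff_empty Diff_insert0)
    then show ?thesis
      by (simp add: bernoulli_mean_insert[OF insert.hyps] flip_diff_insert left_diff_distrib)
  qed
  have "(?M ?g - ?M f)\<^sup>2 \<le> ?M (\<lambda>\<eta>. (?g \<eta> - f \<eta>)\<^sup>2)"
    unfolding bernoulli_mean_diff[symmetric] by (rule bernoulli_mean_jensen[OF insert.hyps(1) assms(2,3)])
  then have "p * (1 - p) * (?M ?g - ?M f)\<^sup>2 \<le> p * (1 - p) * ?M (\<lambda>\<eta>. (?g \<eta> - f \<eta>)\<^sup>2)"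
    using assms by (intro mult_left_mono) auto
  moreover have "p * (?M (\<lambda>\<eta>. (?g \<eta>)\<^sup>2) - (?M ?g)\<^sup>2) \<le> p * (\<Sum>e'\<in>E. ?V e' ?g)"
    using insert.IH[of ?g] assms by (intro mult_left_mono) auto
  moreover have "(1 - p) * (?M (\<lambda>\<eta>. (f \<eta>)\<^sup>2) - (?M f)\<^sup>2) \<le> (1 - p) * (\<Sum>e'\<in>E. ?V e' f)"
    using insert.IH[of f] assms by (intro mult_left_mono) auto
  moreover have "bernoulli_mean (insert e E) p (\<lambda>\<eta>. (f \<eta>)\<^sup>2) - (bernoulli_mean (insert e E) p f)\<^sup>2
      = p * (?M (\<lambda>\<eta>. (?g \<eta>)\<^sup>2) - (?M ?g)\<^sup>2) + (1 - p) * (?M (\<lambda>\<eta>. (f \<eta>)\<^sup>2) - (?M f)\<^sup>2)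
        + p * (1 - p) * (?M ?g - ?M f)\<^sup>2"
    by (simp add: bernoulli_mean_insert[OF insert.hyps] power2_eq_square algebra_simps)
  moreover have "(\<Sum>e'\<in>insert e E. p * (1 - p) * bernoulli_mean (insert e E) p (\<lambda>\<eta>. (flip_diff e' f \<eta>)\<^sup>2))
      = p * (1 - p) * ?M (\<lambda>\<eta>. (?g \<eta> - f \<eta>)\<^sup>2) + (p * (\<Sum>e'\<in>E. ?V e' ?g) + (1 - p) * (\<Sum>e'\<in>E. ?V e' f))"
    using insert.hyps by (simp add: new old sum.distrib sum_distrib_left)
  ultimately show ?case by linarith
qed

lemma square_sum3_le: "(a + b + c)\<^sup>2 \<le> 3 * (a\<^sup>2 + b\<^sup>2 + c\<^sup>2)" for a b c :: real
  using zero_le_power2[of "a - b"] zero_le_power2[of "b - c"] zero_le_power2[of "a - c"]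
  by (simp add: power2_eq_square algebra_simps)

text \<open>The difference of means times \<open>p\<close> is a mean over open \<open>e\<close>
  corrected by two covariances. The 3 is the cost of squaring a sum of three terms. Each squared
  term is at most \<open>p\<close> times its energy, so dividing by the square of \<open>p\<close>
  leaves a single \<open>1 / p\<close>.\<close>

lemma bernoulli_mean_diff_bound:
  assumes "finite E" "e \<in> E" "0 < p" "p \<le> 1"
  shows "(bernoulli_mean E p f - bernoulli_mean E p g)\<^sup>2
    \<le> 3 / p * (bernoulli_mean E p (\<lambda>\<eta>. of_bool (e \<in> \<eta>) * (f \<eta> - g \<eta>)\<^sup>2)
        + p * (1 - p) * bernoulli_mean E p (\<lambda>\<eta>. (flip_diff e f \<eta>)\<^sup>2)
        + p * (1 - p) * bernoulli_mean E p (\<lambda>\<eta>. (flip_diff e g \<eta>)\<^sup>2))"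
proof -
  let ?M = "bernoulli_mean E p"
  let ?W = "?M (\<lambda>\<eta>. of_bool (e \<in> \<eta>) * (f \<eta> - g \<eta>)\<^sup>2)"
  let ?V = "\<lambda>f. p * (1 - p) * ?M (\<lambda>\<eta>. (flip_diff e f \<eta>)\<^sup>2)"
  let ?A = "?M (\<lambda>\<eta>. of_bool (e \<in> \<eta>) * (f \<eta> - g \<eta>))"
  let ?C = "\<lambda>f. p * (1 - p) * ?M (flip_diff e f)"
  have C: "(?C f)\<^sup>2 \<le> p * ?V f" for f
  proof -
    have "(?C f)\<^sup>2 = (p * (1 - p))\<^sup>2 * (?M (flip_diff e f))\<^sup>2" by (simp add: power_mult_distrib)
    also have "\<dots> \<le> (p * (1 - p))\<^sup>2 * ?M (\<lambda>\<eta>. (flip_diff e f \<eta>)\<^sup>2)"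
      using assms by (intro mult_left_mono bernoulli_mean_jensen) auto
    also have "\<dots> = p * (1 - p) * ?V f" by (simp add: power2_eq_square)
    also have "\<dots> \<le> p * ?V f"
    proof (rule mult_right_mono)
      show "0 \<le> ?V f" using assms by (intro mult_nonneg_nonneg bernoulli_mean_nonneg) auto
      show "p * (1 - p) \<le> p" using assms by simp
    qed
    finally show ?thesis .
  qed
  \<comment> \<open>Jensen is applied after conditioning on \<open>e\<close> being open; applied to
    the unconditional mean it would lose the factor \<open>p\<close>.\<close>
  have A: "?A\<^sup>2 \<le> p * ?W"
  proof -
    let ?N = "bernoulli_mean (E - {e}) p"
    have drop: "?M (\<lambda>\<eta>. of_bool (e \<in> \<eta>) * h \<eta>) = p * ?N (\<lambda>\<eta>. h (insert e \<eta>))" for h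
    proof -
      have "?N (\<lambda>\<eta>. of_bool (e \<in> \<eta>) * h \<eta>) = ?N (\<lambda>_. 0)" by (intro bernoulli_mean_cong) auto
      then show ?thesis
        by (subst bernoulli_mean_remove[OF assms(1,2)]) (simp add: bernoulli_mean_def)
    qed
    have "?A\<^sup>2 = p\<^sup>2 * (?N (\<lambda>\<eta>. f (insert e \<eta>) - g (insert e \<eta>)))\<^sup>2"
      unfolding drop by (simp add: power_mult_distrib)
    also have "\<dots> \<le> p\<^sup>2 * ?N (\<lambda>\<eta>. (f (insert e \<eta>) - g (insert e \<eta>))\<^sup>2)"
      using assms by (intro mult_left_mono bernoulli_mean_jensen) auto
    also have "\<dots> = p * ?W" unfolding drop by (simp add: power2_eq_square)
    finally show ?thesis .
  qed
  have "?A = ?M (\<lambda>\<eta>. of_bool (e \<in> \<eta>) * f \<eta>) - ?M (\<lambda>\<eta>. of_bool (e \<in> \<eta>) * g \<eta>)"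
    unfolding bernoulli_mean_diff[symmetric] by (simp add: right_diff_distrib)
  then have "p * (?M f - ?M g) = ?A + (- ?C f) + ?C g"
    unfolding bernoulli_covariance[OF assms(1,2)] by (simp add: algebra_simps)
  then have "p\<^sup>2 * (?M f - ?M g)\<^sup>2 = (?A + (- ?C f) + ?C g)\<^sup>2" by (metis power_mult_distrib)
  also have "\<dots> \<le> 3 * (?A\<^sup>2 + (?C f)\<^sup>2 + (?C g)\<^sup>2)"
    using square_sum3_le[of ?A "- ?C f" "?C g"] by simp
  also have "\<dots> \<le> 3 * (p * ?W + p * ?V f + p * ?V g)"
    using A C[of f] C[of g] by simp
  also have "\<dots> = p\<^sup>2 * (3 / p * (?W + ?V f + ?V g))"
    using assms(3) by (simp add: power2_eq_square algebra_simps)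
  finally show ?thesis using assms(3) by (simp only: mult_le_cancel_left_pos zero_less_power)
qed

section \<open>Spectral gap of the full process\<close>

text \<open>The value \<open>p = 1\<close> is excluded because configurations with a closed edge
  would then have stationary weight 0.\<close>

locale dynamical_percolation = connected_simple_graph V E
  for V :: "'a set" and E :: "'a set set" +
  fixes \<mu> p :: real
  assumes \<mu>: "0 < \<mu>" "\<mu> \<le> 1" and p: "0 < p" "p < 1"
begin

abbreviation "\<pi> \<equiv> srw_stat V E"
abbreviation "M \<equiv> bernoulli_mean E p"
abbreviation "edge_var e f \<equiv> p * (1 - p) * M (\<lambda>\<eta>. (flip_diff e f \<eta>)\<^sup>2)"

lemma edge_var_nonneg: "0 \<le> edge_var e f"
  using p by (intro mult_nonneg_nonneg bernoulli_mean_nonneg) auto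

section \<open>The full process as a reversible chain\<close>

lemma finite_full_states: "finite (full_states V E)"
  using finite_V finite_E by (simp add: full_states_def)

lemma full_mean: "(\<Sum>z\<in>full_states V E. full_stat V E p z * F z) = (\<Sum>x\<in>V. \<pi> x * M (\<lambda>\<eta>. F (x, \<eta>)))"
  unfolding full_states_def sum.cartesian_product'[symmetric]
  by (simp add: full_stat_def bernoulli_stat_def bernoulli_mean_def sum.cartesian_product
      sum_distrib_left mult.assoc case_prod_unfold)

text \<open>All targets of jumps lie in the state space, so each indicator in the rates selects one
  value of \<open>F\<close>. This serves both the Dirichlet form and the backward equation.\<close>

lemma full_rate_apply:
  assumes x: "x \<in> V" and \<eta>: "\<eta> \<subseteq> E"
  shows "(\<Sum>w\<in>full_states V E. full_rate V E \<mu> p (x, \<eta>) w * F w)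
    = (\<Sum>e\<in>E. \<mu> * (p * F (x, insert e \<eta>) + (1 - p) * F (x, \<eta> - {e})))
      + (\<Sum>v\<in>nbrs V E x. 1 / real (deg V E x) * F (if {x, v} \<in> \<eta> then v else x, \<eta>))"
proof -
  let ?S = "full_states V E"
  have pick: "(\<Sum>w\<in>?S. of_bool (w = c) * F w) = F c" if "c \<in> ?S" for c
  proof -
    have "(\<Sum>w\<in>?S. of_bool (w = c) * F w) = (\<Sum>w\<in>?S. if w = c then F w else 0)"
      by (intro sum.cong) auto
    then show ?thesis using that finite_full_states by simp
  qed
  have "(\<Sum>w\<in>?S. full_rate V E \<mu> p (x, \<eta>) w * F w)
      = (\<Sum>w\<in>?S. \<Sum>e\<in>E. \<mu> * (p * (of_bool (w = (x, insert e \<eta>)) * F w)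
            + (1 - p) * (of_bool (w = (x, \<eta> - {e})) * F w)))
        + (\<Sum>w\<in>?S. \<Sum>v\<in>nbrs V E x. 1 / real (deg V E x)
            * (of_bool (w = (if {x, v} \<in> \<eta> then v else x, \<eta>)) * F w))"
    unfolding sum.distrib[symmetric] full_rate_def prod.case distrib_right sum_distrib_right
    by (intro sum.cong arg_cong2[where f = "(+)"] refl) (auto simp: algebra_simps)
  also have "(\<Sum>w\<in>?S. \<Sum>e\<in>E. \<mu> * (p * (of_bool (w = (x, insert e \<eta>)) * F w)
            + (1 - p) * (of_bool (w = (x, \<eta> - {e})) * F w)))
      = (\<Sum>e\<in>E. \<mu> * (p * (\<Sum>w\<in>?S. of_bool (w = (x, insert e \<eta>)) * F w)
            + (1 - p) * (\<Sum>w\<in>?S. of_bool (w = (x, \<eta> - {e})) * F w)))"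
    by (subst sum.swap) (simp only: sum_distrib_left[symmetric] sum.distrib)
  also have "\<dots> = (\<Sum>e\<in>E. \<mu> * (p * F (x, insert e \<eta>) + (1 - p) * F (x, \<eta> - {e})))"
    by (intro sum.cong refl, subst (1 2) pick) (use x \<eta> in \<open>auto simp: full_states_def\<close>)
  also have "(\<Sum>w\<in>?S. \<Sum>v\<in>nbrs V E x. 1 / real (deg V E x)
            * (of_bool (w = (if {x, v} \<in> \<eta> then v else x, \<eta>)) * F w))
      = (\<Sum>v\<in>nbrs V E x. 1 / real (deg V E x)
            * (\<Sum>w\<in>?S. of_bool (w = (if {x, v} \<in> \<eta> then v else x, \<eta>)) * F w))"
    by (subst sum.swap) (simp only: sum_distrib_left)
  also have "\<dots> = (\<Sum>v\<in>nbrs V E x. 1 / real (deg V E x) * F (if {x, v} \<in> \<eta> then v else x, \<eta>))"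
    by (intro sum.cong refl, subst pick) (use x \<eta> in \<open>auto simp: full_states_def nbrs_def\<close>)
  finally show ?thesis .
qed

lemma bernoulli_stat_pos: "0 < bernoulli_stat E p \<eta>"
  unfolding bernoulli_stat_def using p by (intro prod_pos) auto

lemma bernoulli_stat_flip:
  assumes "e \<in> E"
  shows "(1 - p) * bernoulli_stat E p (insert e \<eta>) = p * bernoulli_stat E p (\<eta> - {e})"
proof -
  have "(\<Prod>x\<in>E - {e}. if x \<in> insert e \<eta> then p else 1 - p) = (\<Prod>x\<in>E - {e}. if x \<in> \<eta> - {e} then p else 1 - p)"
    by (intro prod.cong) auto
  then show ?thesis
    unfolding bernoulli_stat_def using finite_E assms by (simp add: prod.remove[of E e])
qed

text \<open>If \<open>e\<close> has the same state in both configurations, a refresh connects them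
  only when they are equal. Otherwise one is the other with \<open>e\<close> flipped, or both sides
  vanish, and the weights compare by \<open>bernoulli_stat_flip\<close>.\<close>

lemma refresh_balance:
  assumes "e \<in> E"
  shows "bernoulli_stat E p \<eta> * (p * of_bool (\<zeta> = insert e \<eta>) + (1 - p) * of_bool (\<zeta> = \<eta> - {e}))
    = bernoulli_stat E p \<zeta> * (p * of_bool (\<eta> = insert e \<zeta>) + (1 - p) * of_bool (\<eta> = \<zeta> - {e}))"
proof -
  consider "e \<in> \<eta>" "e \<in> \<zeta>" | "e \<notin> \<eta>" "e \<notin> \<zeta>" | "e \<in> \<eta>" "e \<notin> \<zeta>" | "e \<notin> \<eta>" "e \<in> \<zeta>" by blast
  then show ?thesis
  proof cases
    case 3
    then have "\<zeta> = \<eta> - {e} \<longleftrightarrow> \<eta> = insert e \<zeta>" "\<zeta> \<noteq> insert e \<eta>" "\<eta> \<noteq> \<zeta> - {e}" by auto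
    then show ?thesis using bernoulli_stat_flip[OF assms, of \<eta>] 3 by (auto simp: insert_absorb mult_ac)
  next
    case 4
    then have "\<eta> = \<zeta> - {e} \<longleftrightarrow> \<zeta> = insert e \<eta>" "\<eta> \<noteq> insert e \<zeta>" "\<zeta> \<noteq> \<eta> - {e}" by auto
    then show ?thesis using bernoulli_stat_flip[OF assms, of \<zeta>] 4 by (auto simp: insert_absorb mult_ac)
  qed (auto simp: insert_absorb)
qed

lemma walk_balance:
  assumes "x \<in> V" "y \<in> V" "\<eta> \<subseteq> E"
  shows "\<pi> x * (\<Sum>v\<in>nbrs V E x. 1 / real (deg V E x)
            * of_bool ((y, \<zeta>) = (if {x, v} \<in> \<eta> then v else x, \<eta>)))
       = \<pi> y * (\<Sum>v\<in>nbrs V E y. 1 / real (deg V E y)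
            * of_bool ((x, \<eta>) = (if {y, v} \<in> \<zeta> then v else y, \<zeta>)))"
\<comment> \<open>For different configurations both sums vanish, and for equal states, which include
  failed jumps, the two sides coincide. Only a move across an open edge remains.\<close>
proof (cases "x = y \<or> \<zeta> \<noteq> \<eta>")
  case True
  then show ?thesis
  proof (cases "\<zeta> = \<eta>")
    case False
    then show ?thesis using not_sym[OF False] by simp
  next
    case eq: True
    then show ?thesis using True by auto
  qed
next
  case False
  have jump: "\<pi> x * (\<Sum>v\<in>nbrs V E x. 1 / real (deg V E x) * of_bool ((y, \<eta>) = (if {x, v} \<in> \<eta> then v else x, \<eta>)))
      = of_bool ({x, y} \<in> \<eta>) / (2 * real (card E))" if "x \<in> V" "x \<noteq> y" for x y
  proof -
    have "(\<Sum>v\<in>nbrs V E x. 1 / real (deg V E x) * of_bool ((y, \<eta>) = (if {x, v} \<in> \<eta> then v else x, \<eta>)))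
        = (\<Sum>v\<in>nbrs V E x. if v = y then 1 / real (deg V E x) * of_bool ({x, y} \<in> \<eta>) else 0)"
      using that by (intro sum.cong) auto
    also have "\<dots> = 1 / real (deg V E x) * of_bool ({x, y} \<in> \<eta>)"
      using finite_nbrs assms(3) by (auto simp: nbrs_eq)
    finally show ?thesis using deg_pos[OF that(1)] by (simp add: srw_stat_def)
  qed
  from False have neq: "x \<noteq> y" "y \<noteq> x" "\<zeta> = \<eta>" by auto
  show ?thesis
    unfolding neq(3) jump[OF assms(1) neq(1)] jump[OF assms(2) neq(2)] by (simp add: insert_commute)
qed

sublocale full: reversible_chain "full_states V E" "full_rate V E \<mu> p" "full_stat V E p"
proof
  show "finite (full_states V E)" by (rule finite_full_states)
  show "0 < full_stat V E p z" if "z \<in> full_states V E" for z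
    using that srw_stat_pos bernoulli_stat_pos by (auto simp: full_stat_def full_states_def)
  show "sum (full_stat V E p) (full_states V E) = 1"
    using full_mean[of "\<lambda>_. 1"] srw_stat_sum by (simp add: bernoulli_mean_const finite_E)
  show "0 \<le> full_rate V E \<mu> p z w" if "z \<in> full_states V E" "w \<in> full_states V E" for z w
    using \<mu> p by (auto simp: full_rate_def split: prod.split intro!: add_nonneg_nonneg sum_nonneg)
  show "full_stat V E p z * full_rate V E \<mu> p z w = full_stat V E p w * full_rate V E \<mu> p w z"
    if zw: "z \<in> full_states V E" "w \<in> full_states V E" for z w
  proof -
    obtain x \<eta> y \<zeta> where eq: "z = (x, \<eta>)" "w = (y, \<zeta>)" and xy: "x \<in> V" "y \<in> V" "\<eta> \<subseteq> E" "\<zeta> \<subseteq> E"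
      using zw by (auto simp: full_states_def)
    let ?b = "bernoulli_stat E p"
    let ?R = "\<lambda>x \<eta> y \<zeta> e. p * of_bool ((y, \<zeta>) = (x, insert e \<eta>)) + (1 - p) * of_bool ((y, \<zeta>) = (x, \<eta> - {e}))"
    let ?J = "\<lambda>x \<eta> y \<zeta>. \<Sum>v\<in>nbrs V E x. 1 / real (deg V E x)
            * of_bool ((y, \<zeta>) = (if {x, v} \<in> \<eta> then v else x, \<eta>))"
    have env: "\<pi> x * ?b \<eta> * (\<Sum>e\<in>E. \<mu> * ?R x \<eta> y \<zeta> e) = \<pi> y * ?b \<zeta> * (\<Sum>e\<in>E. \<mu> * ?R y \<zeta> x \<eta> e)"
      unfolding sum_distrib_left
    proof (rule sum.cong[OF refl])
      fix e assume "e \<in> E"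
      show "\<pi> x * ?b \<eta> * (\<mu> * ?R x \<eta> y \<zeta> e) = \<pi> y * ?b \<zeta> * (\<mu> * ?R y \<zeta> x \<eta> e)"
        using refresh_balance[OF \<open>e \<in> E\<close>, of \<eta> \<zeta>] by (cases "x = y") (simp_all add: mult_ac)
    qed
    have "\<pi> x * ?b \<eta> * ?J x \<eta> y \<zeta> = \<pi> y * ?b \<zeta> * ?J y \<zeta> x \<eta>"
    proof (cases "\<eta> = \<zeta>")
      case True
      then show ?thesis using walk_balance[OF xy(1-3), of \<zeta>] by (simp only: mult_ac)
    qed auto
    with env show ?thesis by (simp only: eq full_stat_def full_rate_def prod.case distrib_left)
  qed
qed

section \<open>Energy comparison and the Poincare inequality\<close>

definition walk_energy :: "('a \<times> 'a set set \<Rightarrow> real) \<Rightarrow> 'a \<Rightarrow> 'a \<Rightarrow> real" where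
  "walk_energy F x v = M (\<lambda>\<eta>. of_bool ({x, v} \<in> \<eta>) * (F (x, \<eta>) - F (v, \<eta>))\<^sup>2)"

lemma nbrs_sum: "(\<Sum>v\<in>nbrs V E x. 1 / real (deg V E x) * h v) = (\<Sum>v\<in>V. srw_matrix V E x v * h v)"
  unfolding nbrs_def srw_matrix_def
  by (simp only: sum.inter_filter[OF finite_V]) (intro sum.cong, auto)

text \<open>The factor 1/2 of the Dirichlet form survives on the walk part only: on the refresh part
  it cancels the 2 of \<open>bernoulli_resample_energy\<close>.\<close>

lemma full_dirichlet:
  "full.dirichlet F = \<mu> * (\<Sum>x\<in>V. \<pi> x * (\<Sum>e\<in>E. edge_var e (\<lambda>\<eta>. F (x, \<eta>))))
     + (1/2) * (\<Sum>x\<in>V. \<pi> x * (\<Sum>v\<in>V. srw_matrix V E x v * walk_energy F x v))"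
proof -
  let ?env = "\<lambda>x \<eta> e. p * (F (x, \<eta>) - F (x, insert e \<eta>))\<^sup>2 + (1 - p) * (F (x, \<eta>) - F (x, \<eta> - {e}))\<^sup>2"
  let ?walk = "\<lambda>x \<eta> v. of_bool ({x, v} \<in> \<eta>) * (F (x, \<eta>) - F (v, \<eta>))\<^sup>2"
  have "full.dirichlet F = (1/2) * (\<Sum>z\<in>full_states V E. full_stat V E p z
      * (\<Sum>w\<in>full_states V E. full_rate V E \<mu> p z w * (F z - F w)\<^sup>2))"
    unfolding full.dirichlet_def by (simp add: sum_distrib_left mult.assoc)
  also have "\<dots> = (1/2) * (\<Sum>x\<in>V. \<pi> x * M (\<lambda>\<eta>.
      \<Sum>w\<in>full_states V E. full_rate V E \<mu> p (x, \<eta>) w * (F (x, \<eta>) - F w)\<^sup>2))"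
    by (simp only: full_mean)
  also have "\<dots> = (1/2) * (\<Sum>x\<in>V. \<pi> x * (2 * (\<mu> * (\<Sum>e\<in>E. edge_var e (\<lambda>\<eta>. F (x, \<eta>))))
      + (\<Sum>v\<in>V. srw_matrix V E x v * walk_energy F x v)))"
  proof (intro arg_cong[where f = "\<lambda>t. 1/2 * t"] sum.cong refl)
    fix x assume x: "x \<in> V"
    have "M (\<lambda>\<eta>. \<Sum>w\<in>full_states V E. full_rate V E \<mu> p (x, \<eta>) w * (F (x, \<eta>) - F w)\<^sup>2)
        = M (\<lambda>\<eta>. \<mu> * (\<Sum>e\<in>E. ?env x \<eta> e) + (\<Sum>v\<in>V. srw_matrix V E x v * ?walk x \<eta> v))"
    proof (rule bernoulli_mean_cong)
      fix \<eta> assume "\<eta> \<subseteq> E"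
      have "(\<Sum>v\<in>nbrs V E x. 1 / real (deg V E x) * (F (x, \<eta>) - F (if {x, v} \<in> \<eta> then v else x, \<eta>))\<^sup>2)
          = (\<Sum>v\<in>nbrs V E x. 1 / real (deg V E x) * ?walk x \<eta> v)"
        by (intro sum.cong) auto
      then show "(\<Sum>w\<in>full_states V E. full_rate V E \<mu> p (x, \<eta>) w * (F (x, \<eta>) - F w)\<^sup>2)
          = \<mu> * (\<Sum>e\<in>E. ?env x \<eta> e) + (\<Sum>v\<in>V. srw_matrix V E x v * ?walk x \<eta> v)"
        unfolding full_rate_apply[OF x \<open>\<eta> \<subseteq> E\<close>] nbrs_sum[symmetric]
        by (simp add: sum_distrib_left)
    qed
    also have "\<dots> = \<mu> * (\<Sum>e\<in>E. M (\<lambda>\<eta>. ?env x \<eta> e)) + (\<Sum>v\<in>V. srw_matrix V E x v * walk_energy F x v)"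
      by (simp only: bernoulli_mean_add[where f = "\<lambda>\<eta>. \<mu> * (\<Sum>e\<in>E. ?env x \<eta> e)"] bernoulli_mean_sum
          bernoulli_mean_cmult walk_energy_def)
    also have "(\<Sum>e\<in>E. M (\<lambda>\<eta>. ?env x \<eta> e)) = (\<Sum>e\<in>E. 2 * edge_var e (\<lambda>\<eta>. F (x, \<eta>)))"
      by (intro sum.cong refl bernoulli_resample_energy finite_E)
    finally show "\<pi> x * M (\<lambda>\<eta>. \<Sum>w\<in>full_states V E. full_rate V E \<mu> p (x, \<eta>) w * (F (x, \<eta>) - F w)\<^sup>2)
        = \<pi> x * (2 * (\<mu> * (\<Sum>e\<in>E. edge_var e (\<lambda>\<eta>. F (x, \<eta>))))
            + (\<Sum>v\<in>V. srw_matrix V E x v * walk_energy F x v))"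
      by (simp only: sum_distrib_left mult_ac)
  qed
  also have "\<dots> = \<mu> * (\<Sum>x\<in>V. \<pi> x * (\<Sum>e\<in>E. edge_var e (\<lambda>\<eta>. F (x, \<eta>))))
     + (1/2) * (\<Sum>x\<in>V. \<pi> x * (\<Sum>v\<in>V. srw_matrix V E x v * walk_energy F x v))"
    unfolding distrib_left sum.distrib by (simp add: sum_distrib_left mult_ac)
  finally show ?thesis .
qed

text \<open>The edges at \<open>x\<close> are distinct members of \<open>E\<close>, and each weight
  is at most 1. This crude bound suffices because the refresh energy sums over all edges
  anyway.\<close>

lemma incident_edge_var_le:
  "(\<Sum>v\<in>V. srw_matrix V E x v * edge_var {x, v} f) \<le> (\<Sum>e\<in>E. edge_var e f)"
proof -
  have "(\<Sum>v\<in>V. srw_matrix V E x v * edge_var {x, v} f) = (\<Sum>v\<in>nbrs V E x. 1 / real (deg V E x) * edge_var {x, v} f)"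
    by (simp only: nbrs_sum)
  also have "\<dots> \<le> (\<Sum>v\<in>nbrs V E x. 1 * edge_var {x, v} f)"
  proof (intro sum_mono mult_right_mono edge_var_nonneg)
    fix v assume "v \<in> nbrs V E x"
    then have "0 < deg V E x" using finite_nbrs by (auto simp: deg_def card_gt_0_iff)
    then show "1 / real (deg V E x) \<le> 1" by (simp add: Suc_le_eq)
  qed
  also have "\<dots> = (\<Sum>e\<in>(\<lambda>v. {x, v}) ` nbrs V E x. edge_var e f)"
    by (subst sum.reindex) (auto simp: inj_on_def doubleton_eq_iff)
  also have "\<dots> \<le> (\<Sum>e\<in>E. edge_var e f)"
    using finite_E by (intro sum_mono2 edge_var_nonneg) (auto simp: nbrs_eq)
  finally show ?thesis .
qed

lemma full_poincare: "full.poincare (\<mu> * p / (5 * srw_rel_time V E))"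
  unfolding full.poincare_def
proof (intro allI impI)
  fix F assume F0: "(\<Sum>z\<in>full_states V E. full_stat V E p z * F z) = 0"
  let ?P = "srw_matrix V E"
  define T where "T = srw_rel_time V E"
  define f where "f x = M (\<lambda>\<eta>. F (x, \<eta>))" for x
  define A where "A = (\<Sum>x\<in>V. \<pi> x * (\<Sum>e\<in>E. edge_var e (\<lambda>\<eta>. F (x, \<eta>))))"
  define W where "W = (1/2) * (\<Sum>x\<in>V. \<pi> x * (\<Sum>v\<in>V. ?P x v * walk_energy F x v))"
  define B where "B x v = edge_var {x, v} (\<lambda>\<eta>. F (x, \<eta>))" for x v
  have T: "1 / 2 \<le> T" unfolding T_def by (rule srw_rel_time_ge)
  have pi: "0 \<le> \<pi> x" if "x \<in> V" for x using srw_stat_pos[OF that] by simp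
  have A0: "0 \<le> A" unfolding A_def by (intro sum_nonneg mult_nonneg_nonneg pi edge_var_nonneg)
  have W0: "0 \<le> W" unfolding W_def walk_energy_def using p
    by (intro mult_nonneg_nonneg sum_nonneg pi bernoulli_mean_nonneg) (auto simp: srw_matrix_def)
  have "srw.dirichlet f \<le> 3 / p * (W + A)"
  proof -
    have "srw.dirichlet f = (1/2) * (\<Sum>x\<in>V. \<Sum>v\<in>V. \<pi> x * ?P x v * (f x - f v)\<^sup>2)"
      by (rule srw.dirichlet_def)
    also have "\<dots> \<le> (1/2) * (\<Sum>x\<in>V. \<Sum>v\<in>V. \<pi> x * ?P x v * (3 / p * (walk_energy F x v + B x v + B v x)))"
    proof (rule mult_left_mono[OF sum_mono[OF sum_mono]])
      fix x v assume xv: "x \<in> V" "v \<in> V"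
      show "\<pi> x * ?P x v * (f x - f v)\<^sup>2 \<le> \<pi> x * ?P x v * (3 / p * (walk_energy F x v + B x v + B v x))"
      proof (cases "{x, v} \<in> E")
        case True
        have "(f x - f v)\<^sup>2 \<le> 3 / p * (walk_energy F x v + B x v + B v x)"
          using bernoulli_mean_diff_bound[OF finite_E True, of p "\<lambda>\<eta>. F (x, \<eta>)" "\<lambda>\<eta>. F (v, \<eta>)"] p
          by (simp add: f_def walk_energy_def B_def insert_commute)
        then show ?thesis using xv by (intro mult_left_mono) (auto simp: srw_stat_rate)
      qed (simp add: srw_matrix_def)
    qed simp
    also have "\<dots> = 3 / p * ((1/2) * (\<Sum>x\<in>V. \<Sum>v\<in>V. \<pi> x * ?P x v * walk_energy F x v)
        + (1/2) * (\<Sum>x\<in>V. \<Sum>v\<in>V. \<pi> x * ?P x v * B x v) + (1/2) * (\<Sum>x\<in>V. \<Sum>v\<in>V. \<pi> x * ?P x v * B v x))"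
    proof -
      have "\<pi> x * ?P x v * (3 / p * (walk_energy F x v + B x v + B v x))
          = 3 / p * (\<pi> x * ?P x v * walk_energy F x v) + 3 / p * (\<pi> x * ?P x v * B x v)
            + 3 / p * (\<pi> x * ?P x v * B v x)" for x v
        by (simp only: distrib_left mult.left_commute)
      then show ?thesis by (simp only: sum.distrib sum_distrib_left[symmetric]) (simp only: distrib_left mult.left_commute)
    qed
    \<comment> \<open>Although \<open>B\<close> is not symmetric, reversibility makes the two
      covariance sums equal, so their halves add up to one full sum.\<close>
    also have "(\<Sum>x\<in>V. \<Sum>v\<in>V. \<pi> x * ?P x v * B v x) = (\<Sum>x\<in>V. \<Sum>v\<in>V. \<pi> x * ?P x v * B x v)"
      by (subst sum.swap) (intro sum.cong refl, simp add: srw.balance)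
    also have "(1/2) * (\<Sum>x\<in>V. \<Sum>v\<in>V. \<pi> x * ?P x v * walk_energy F x v) = W"
      by (simp add: W_def sum_distrib_left mult.assoc)
    also have "3 / p * (W + (1/2) * (\<Sum>x\<in>V. \<Sum>v\<in>V. \<pi> x * ?P x v * B x v)
        + (1/2) * (\<Sum>x\<in>V. \<Sum>v\<in>V. \<pi> x * ?P x v * B x v))
        = 3 / p * (W + (\<Sum>x\<in>V. \<pi> x * (\<Sum>v\<in>V. ?P x v * B x v)))"
      by (simp add: sum_distrib_left mult.assoc)
    also have "\<dots> \<le> 3 / p * (W + A)"
      unfolding A_def B_def using p
      by (intro mult_left_mono add_left_mono sum_mono incident_edge_var_le pi) auto
    finally show ?thesis .
  qed
  moreover have "1 / T * (\<Sum>x\<in>V. \<pi> x * (f x)\<^sup>2) \<le> srw.dirichlet f"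
  proof -
    have "(\<Sum>x\<in>V. \<pi> x * f x) = 0" using F0 unfolding full_mean f_def .
    then show ?thesis using srw_poincare unfolding srw.poincare_def T_def by blast
  qed
  ultimately have "1 / T * (\<Sum>x\<in>V. \<pi> x * (f x)\<^sup>2) \<le> 3 / p * (W + A)" by (rule order_trans[rotated])
  then have "T * (1 / T * (\<Sum>x\<in>V. \<pi> x * (f x)\<^sup>2)) \<le> T * (3 / p * (W + A))"
    using T by (intro mult_left_mono) auto
  then have mean: "(\<Sum>x\<in>V. \<pi> x * (f x)\<^sup>2) \<le> T * (3 / p * (W + A))"
    using T by simp
  have "(\<Sum>x\<in>V. \<pi> x * M (\<lambda>\<eta>. (F (x, \<eta>))\<^sup>2))
      \<le> (\<Sum>x\<in>V. \<pi> x * ((f x)\<^sup>2 + (\<Sum>e\<in>E. edge_var e (\<lambda>\<eta>. F (x, \<eta>)))))"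
  proof (intro sum_mono mult_left_mono pi)
    fix x
    show "M (\<lambda>\<eta>. (F (x, \<eta>))\<^sup>2) \<le> (f x)\<^sup>2 + (\<Sum>e\<in>E. edge_var e (\<lambda>\<eta>. F (x, \<eta>)))"
      using bernoulli_efron_stein[OF finite_E, of p "\<lambda>\<eta>. F (x, \<eta>)"] p by (simp add: f_def)
  qed
  also have "\<dots> = (\<Sum>x\<in>V. \<pi> x * (f x)\<^sup>2) + A" by (simp add: A_def distrib_left sum.distrib)
  also have "\<dots> \<le> T * (3 / p * (W + A)) + A" using mean by simp
  \<comment> \<open>The 5 is 3 from the variance of the averages plus 2 for absorbing the fibre
    variance \<open>A\<close>, which uses \<open>p \<le> 2 * T\<close>.\<close>
  also have "\<dots> \<le> 5 * T / p * (W + A)"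
  proof -
    have "A \<le> W + A" using W0 by simp
    also have "\<dots> \<le> 2 * T / p * (W + A)"
    proof -
      have "p \<le> 2 * T" using T p by linarith
      then have "1 \<le> 2 * T / p" using p by (simp add: field_simps)
      then show ?thesis using A0 W0 mult_right_mono[of 1 "2 * T / p" "W + A"] by simp
    qed
    finally have "A \<le> 2 * T / p * (W + A)" .
    moreover have "5 * T / p * (W + A) = T * (3 / p * (W + A)) + 2 * T / p * (W + A)"
      using p by (simp add: field_simps)
    ultimately show ?thesis by linarith
  qed
  also have "\<dots> \<le> 5 * T / (\<mu> * p) * (\<mu> * A + W)"
  proof -
    \<comment> \<open>The Dirichlet form weights only the refresh part with \<open>\<mu>\<close>;
      since \<open>\<mu> \<le> 1\<close>, lowering the walk part to the same weight is
      allowed.\<close>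
    have "\<mu> * (W + A) \<le> \<mu> * A + W"
      using \<mu> W0 mult_right_mono[of \<mu> 1 W] by (simp add: algebra_simps)
    then have "5 * T / (\<mu> * p) * (\<mu> * (W + A)) \<le> 5 * T / (\<mu> * p) * (\<mu> * A + W)"
      using T \<mu> p by (intro mult_left_mono) auto
    then show ?thesis using \<mu> by simp
  qed
  finally have "(\<Sum>x\<in>V. \<pi> x * M (\<lambda>\<eta>. (F (x, \<eta>))\<^sup>2)) \<le> 5 * T / (\<mu> * p) * full.dirichlet F"
    unfolding full_dirichlet A_def W_def .
  then show "\<mu> * p / (5 * srw_rel_time V E) * (\<Sum>z\<in>full_states V E. full_stat V E p z * (F z)\<^sup>2) \<le> full.dirichlet F"
    unfolding full_mean T_def[symmetric]
  proof -
    let ?N = "\<Sum>x\<in>V. \<pi> x * M (\<lambda>\<eta>. (F (x, \<eta>))\<^sup>2)"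
    assume "?N \<le> 5 * T / (\<mu> * p) * full.dirichlet F"
    then have "\<mu> * p / (5 * T) * ?N \<le> \<mu> * p / (5 * T) * (5 * T / (\<mu> * p) * full.dirichlet F)"
      using T \<mu> p by (intro mult_left_mono) auto
    then show "\<mu> * p / (5 * T) * ?N \<le> full.dirichlet F" using T \<mu> p by simp
  qed
qed

end

section \<open>Mixing of the full process\<close>

context dynamical_percolation
begin

text \<open>The probability that an edge started in its state in \<open>\<zeta>\<close> has its
  state in \<open>\<eta>\<close> at time \<open>t\<close>: without a refresh, of probability
  \<open>exp (- \<mu> * t)\<close>, the states must agree, and otherwise the Bernoulli weight
  applies.\<close>

definition edge_prob :: "real \<Rightarrow> 'a set set \<Rightarrow> 'a set \<Rightarrow> 'a set set \<Rightarrow> real" where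
  "edge_prob t \<eta> e \<zeta> = (if e \<in> \<eta> then p else 1 - p)
     + exp (- \<mu> * t) * (of_bool (e \<in> \<zeta> \<longleftrightarrow> e \<in> \<eta>) - (if e \<in> \<eta> then p else 1 - p))"

text \<open>The product on the left solves the backward equation of the full process, because the
  environment evolves autonomously and its edges are independent.\<close>

lemma environment_law:
  assumes x: "x \<in> V" and \<zeta>: "\<zeta> \<subseteq> E" and \<eta>: "\<eta> \<subseteq> E"
  shows "(\<Prod>e\<in>E. edge_prob t \<eta> e \<zeta>)
    = (\<Sum>w\<in>full_states V E. full.P t (x, \<zeta>) w * of_bool (snd w = \<eta>))"
proof -
  let ?S = "full_states V E"
  define b where "b e = (if e \<in> \<eta> then p else 1 - p)" for e
  define u where "u t z = (\<Prod>e\<in>E. edge_prob t \<eta> e (snd z))" for t and z :: "'a \<times> 'a set set"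
  define R where "R t e \<zeta> = (\<Prod>e'\<in>E - {e}. edge_prob t \<eta> e' \<zeta>)" for t e \<zeta>
  have u_split: "u t (x, \<zeta>) = edge_prob t \<eta> e \<zeta> * R t e \<zeta>" if "e \<in> E" for t x e \<zeta>
    using that finite_E by (simp add: u_def R_def prod.remove)
  have R_cong: "R t e (insert e \<zeta>) = R t e \<zeta>" "R t e (\<zeta> - {e}) = R t e \<zeta>" for t e \<zeta>
    unfolding R_def by (intro prod.cong; simp add: edge_prob_def)+
  have ode: "((\<lambda>t. u t z) has_real_derivative (\<Sum>w\<in>?S. full.L z w * u t w)) (at t)" if "z \<in> ?S" for z t
  proof -
    obtain x \<zeta> where z: "z = (x, \<zeta>)" "x \<in> V" "\<zeta> \<subseteq> E" using \<open>z \<in> ?S\<close> by (auto simp: full_states_def)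
    have "((\<lambda>t. u t z) has_real_derivative (\<Sum>e\<in>E. \<mu> * (b e - edge_prob t \<eta> e \<zeta>) * R t e \<zeta>)) (at t)"
      unfolding u_def R_def z snd_conv
      by (rule has_field_derivative_prod) (auto simp: edge_prob_def b_def algebra_simps intro!: derivative_eq_intros)
    moreover have "(\<Sum>w\<in>?S. full.L z w * u t w) = (\<Sum>e\<in>E. \<mu> * (b e - edge_prob t \<eta> e \<zeta>) * R t e \<zeta>)"
    proof -
      have "(\<Sum>w\<in>?S. full.L z w * u t w) = (\<Sum>w\<in>?S. full_rate V E \<mu> p (x, \<zeta>) w * (u t w - u t (x, \<zeta>)))"
        using full.generator_apply[OF \<open>z \<in> ?S\<close>] by (simp add: z)
      \<comment> \<open>The walk terms vanish, since \<open>u\<close> depends on the configuration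
        alone and jumps of the walk do not change it.\<close>
      also have "\<dots> = (\<Sum>e\<in>E. \<mu> * (p * (u t (x, insert e \<zeta>) - u t (x, \<zeta>)) + (1 - p) * (u t (x, \<zeta> - {e}) - u t (x, \<zeta>))))"
        unfolding full_rate_apply[OF z(2,3)] by (simp add: u_def)
      also have "\<dots> = (\<Sum>e\<in>E. \<mu> * (b e - edge_prob t \<eta> e \<zeta>) * R t e \<zeta>)"
      proof (rule sum.cong[OF refl])
        fix e assume e: "e \<in> E"
        \<comment> \<open>A freshly refreshed edge is in equilibrium, so its matching probability is
          the Bernoulli weight at every time.\<close>
        have avg: "p * edge_prob t \<eta> e (insert e \<zeta>) + (1 - p) * edge_prob t \<eta> e (\<zeta> - {e}) = b e"
          by (simp add: edge_prob_def b_def algebra_simps)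
        show "\<mu> * (p * (u t (x, insert e \<zeta>) - u t (x, \<zeta>)) + (1 - p) * (u t (x, \<zeta> - {e}) - u t (x, \<zeta>)))
            = \<mu> * (b e - edge_prob t \<eta> e \<zeta>) * R t e \<zeta>"
          unfolding u_split[OF e] R_cong avg[symmetric] by (simp add: algebra_simps)
      qed
      finally show ?thesis .
    qed
    ultimately show ?thesis by simp
  qed
  have "u t (x, \<zeta>) = (\<Sum>w\<in>?S. full.P t (x, \<zeta>) w * u 0 w)"
    by (rule full.prob_unique[OF ode]) (use x \<zeta> in \<open>auto simp: full_states_def\<close>)
  also have "\<dots> = (\<Sum>w\<in>?S. full.P t (x, \<zeta>) w * of_bool (snd w = \<eta>))"
  proof (rule sum.cong[OF refl])
    fix w assume "w \<in> ?S"
    then have "snd w \<subseteq> E" by (auto simp: full_states_def)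
    have "u 0 w = (\<Prod>e\<in>E. of_bool (e \<in> snd w \<longleftrightarrow> e \<in> \<eta>))" by (simp add: u_def edge_prob_def)
    also have "\<dots> = of_bool (snd w = \<eta>)"
    proof (cases "snd w = \<eta>")
      case False
      then obtain e where "e \<in> E" "(e \<in> snd w) \<noteq> (e \<in> \<eta>)" using \<open>snd w \<subseteq> E\<close> \<eta> by blast
      then show ?thesis using finite_E False by (auto intro!: prod_zero)
    qed simp
    finally show "full.P t (x, \<zeta>) w * u 0 w = full.P t (x, \<zeta>) w * of_bool (snd w = \<eta>)" by simp
  qed
  finally show ?thesis by (simp add: u_def)
qed

text \<open>Forgetting the position of the walk leaves the return probability of the environment, a
  product over edges. After this time each factor exceeds its Bernoulli weight by a factor of at
  most \<open>1 + 1 / card E\<close>, so the product loses at most \<open>exp 1\<close>.\<close>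

lemma return_density_bound:
  assumes z: "z \<in> full_states V E" and t: "(ln (card E) - ln p - ln (1 - p)) / \<mu> \<le> t" "0 \<le> t"
  shows "full.P t z z / full_stat V E p z \<le> exp 1 * (real (card V))\<^sup>2"
proof -
  obtain x \<eta> where eq: "z = (x, \<eta>)" and x: "x \<in> V" and \<eta>: "\<eta> \<subseteq> E"
    using z by (auto simp: full_states_def)
  define b where "b e = (if e \<in> \<eta> then p else 1 - p)" for e
  define m where "m = real (card E)"
  define X where "X = exp (- \<mu> * t)"
  have m: "m > 0" using card_E_pos by (simp add: m_def)
  have b: "0 < b e" "b e < 1" for e using p by (auto simp: b_def)
  have X: "X \<le> p * (1 - p) / m"
  proof -
    have "ln m - ln p - ln (1 - p) \<le> \<mu> * t" using t(1) \<mu> by (simp add: m_def field_simps)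
    then have "X \<le> exp (ln p + ln (1 - p) - ln m)" unfolding X_def by simp
    also have "\<dots> = p * (1 - p) / m" using p m by (simp add: exp_add exp_diff)
    finally show ?thesis .
  qed
  have edge: "edge_prob t \<eta> e \<eta> \<le> b e * exp (1 / m)" "0 \<le> edge_prob t \<eta> e \<eta>" for e
  proof -
    have q: "edge_prob t \<eta> e \<eta> = b e + X * (1 - b e)" by (simp add: edge_prob_def b_def X_def)
    then show "0 \<le> edge_prob t \<eta> e \<eta>" using b[of e] by (simp add: X_def)
    \<comment> \<open>The bound \<open>p * (1 - p)\<close> is below both \<open>p\<close> and
      \<open>1 - p\<close>, so it works for either state of \<open>e\<close>.\<close>
    have "X * (1 - b e) \<le> p * (1 - p) / m * 1" using X b[of e] p m by (intro mult_mono) auto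
    also have "\<dots> \<le> b e / m" using p m by (auto simp: b_def divide_simps mult_le_cancel_left1)
    finally have "edge_prob t \<eta> e \<eta> \<le> b e * (1 + 1 / m)" by (simp add: q distrib_left)
    also have "\<dots> \<le> b e * exp (1 / m)" using b[of e] by (intro mult_left_mono) (auto intro: exp_ge_add_one_self)
    finally show "edge_prob t \<eta> e \<eta> \<le> b e * exp (1 / m)" .
  qed
  have "full.P t z z = (\<Sum>w\<in>{z}. full.P t z w * of_bool (snd w = \<eta>))" by (simp add: eq)
  also have "\<dots> \<le> (\<Sum>w\<in>full_states V E. full.P t z w * of_bool (snd w = \<eta>))"
    using z t(2) finite_full_states by (intro sum_mono2) (auto intro!: full.prob_nonneg)
  also have "\<dots> = (\<Prod>e\<in>E. edge_prob t \<eta> e \<eta>)" unfolding eq using environment_law[OF x \<eta> \<eta>] by simp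
  also have "\<dots> \<le> (\<Prod>e\<in>E. b e * exp (1 / m))" by (intro prod_mono) (simp add: edge)
  also have "\<dots> = bernoulli_stat E p \<eta> * exp 1"
    using m by (simp add: prod.distrib bernoulli_stat_def b_def m_def flip: exp_of_nat_mult)
  finally have "full.P t z z / full_stat V E p z \<le> bernoulli_stat E p \<eta> * exp 1 / full_stat V E p z"
    using full.stat_pos[OF z] by (simp add: divide_right_mono)
  also have "\<dots> = exp 1 * (1 / \<pi> x)"
    using bernoulli_stat_pos[of \<eta>] by (simp add: eq full_stat_def)
  also have "\<dots> \<le> exp 1 * (real (card V))\<^sup>2"
    using inverse_srw_stat_le[OF x] by (intro mult_left_mono) auto
  finally show ?thesis .
qed

lemma full_Linf_mixing_time_le:
  assumes "1 \<le> k"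
  shows "full_Linf_mixing_time V E \<mu> p (1 / real (card V) ^ k)
    \<le> ereal (40 * real k * (1 / (\<mu> * p) * (srw_rel_time V E * ln (real (card V))) + 1 / \<mu> * \<bar>ln (1 - p)\<bar>))"
proof -
  define n where "n = real (card V)"
  define T where "T = srw_rel_time V E"
  define \<gamma> where "\<gamma> = \<mu> * p / (5 * T)"
  \<comment> \<open>The burn-in time after which the return density is bounded by
    \<open>exp 1 * n\<^sup>2\<close>.\<close>
  define t0 where "t0 = (ln (card E) - ln p - ln (1 - p)) / \<mu>"
  \<comment> \<open>Of the exponent \<open>5 * k * ln n\<close>, one fifth gives the target
    \<open>1 / n ^ k\<close>; the rest is at least \<open>4 * ln n\<close> and absorbs the factor
    \<open>exp 1 * n\<^sup>2\<close>, because \<open>1 \<le> 2 * ln n\<close>.\<close>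
  define s where "s = 5 * real k * ln n / \<gamma>"
  have n: "2 \<le> n" using card_V by (simp add: n_def)
  have T: "1 / 2 \<le> T" unfolding T_def by (rule srw_rel_time_ge)
  have \<gamma>: "0 < \<gamma>" using \<mu> p T by (simp add: \<gamma>_def)
  have k: "1 \<le> real k" using assms by simp
  have ln2: "1 / 2 \<le> ln (2::real)"
  proof -
    have "exp (1 / 2 :: real) \<le> 1 + 1 / 2 + (1 / 2)\<^sup>2" by (rule exp_bound) auto
    also have "\<dots> \<le> 2" by (simp add: power2_eq_square)
    finally show ?thesis by (subst ln_ge_iff) auto
  qed
  have lnn: "1 / 2 \<le> ln n" using ln2 n by (simp add: order_trans)
  have s: "0 \<le> s" using \<gamma> lnn by (simp add: s_def)
  have lnE: "0 \<le> ln (real (card E))" "ln (real (card E)) \<le> 2 * ln n"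
  proof -
    show "0 \<le> ln (real (card E))" using card_E_pos by (simp add: Suc_le_eq)
    have "real (card E) \<le> real ((card V)\<^sup>2)" using card_E_le by (simp only: of_nat_le_iff)
    then have "real (card E) \<le> n\<^sup>2" by (simp only: n_def of_nat_power)
    then have "ln (real (card E)) \<le> ln (n\<^sup>2)" using card_E_pos n by (subst ln_le_cancel_iff) auto
    then show "ln (real (card E)) \<le> 2 * ln n" using n by (simp add: ln_realpow)
  qed
  have lnp: "ln p \<le> 0" "ln (1 - p) \<le> 0" using p by auto
  have t0: "0 \<le> t0" using lnE lnp \<mu> by (simp add: t0_def)
  \<comment> \<open>The burn-in is split in halves around the decay period, since the density bound
    involves return densities at twice the outer time.\<close>
  have dens: "\<bar>full.P (t0 / 2 + (s + t0 / 2)) z w / full_stat V E p w - 1\<bar> \<le> 1 / n ^ k"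
    if zw: "z \<in> full_states V E" "w \<in> full_states V E" for z w
  proof -
    have ret: "full.P (t0 / 2 + t0 / 2) z z / full_stat V E p z \<le> exp 1 * n\<^sup>2" if "z \<in> full_states V E" for z
      using return_density_bound[OF that, of t0] t0 by (simp add: t0_def n_def)
    have ret0: "0 \<le> full.P (t0 / 2 + t0 / 2) z z / full_stat V E p z" if "z \<in> full_states V E" for z
      using full.prob_nonneg[OF that that] t0 full.stat_pos[OF that] by simp
    have "\<bar>full.P (t0 / 2 + (s + t0 / 2)) z w / full_stat V E p w - 1\<bar>
        \<le> exp (- \<gamma> * s) * sqrt (full.P (t0 / 2 + t0 / 2) z z / full_stat V E p z
            * (full.P (t0 / 2 + t0 / 2) w w / full_stat V E p w))"
      using full.density_bound[OF full_poincare zw s, of "t0 / 2"] by (simp add: \<gamma>_def T_def)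
    also have "\<dots> \<le> exp (- \<gamma> * s) * sqrt (exp 1 * n\<^sup>2 * (exp 1 * n\<^sup>2))"
      using zw ret ret0 n by (intro mult_left_mono real_sqrt_le_mono mult_mono) auto
    also have "\<dots> = exp (- (5 * real k * ln n)) * (exp 1 * n\<^sup>2)"
      using \<gamma> by (simp only: real_sqrt_abs2) (simp add: s_def abs_mult)
    also have "\<dots> = exp (- (5 * real k * ln n) + 1 + 2 * ln n)"
    proof -
      have "exp (2 * ln n) = n\<^sup>2" using n by (simp add: exp_double)
      then show ?thesis by (simp only: exp_add mult.assoc)
    qed
    also have "\<dots> \<le> exp (- (real k * ln n))"
    proof -
      have "ln n \<le> real k * ln n" using k lnn mult_right_mono[of 1 "real k" "ln n"] by simp
      then have "- (5 * real k * ln n) + 1 + 2 * ln n \<le> - (real k * ln n)" using lnn by linarith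
      then show ?thesis by (simp only: exp_le_cancel_iff)
    qed
    also have "\<dots> = 1 / n ^ k" using n by (simp add: exp_minus exp_of_nat_mult divide_inverse)
    finally show ?thesis .
  qed
  have "full_Linf_mixing_time V E \<mu> p (1 / n ^ k) \<le> ereal (t0 / 2 + (s + t0 / 2))"
    unfolding full_Linf_mixing_time_def Linf_mixing_time_def using t0 s dens by (intro Inf_lower) auto
  also have "t0 / 2 + (s + t0 / 2) = t0 + s" by simp
  also have "t0 + s \<le> 40 * real k * (1 / (\<mu> * p) * (T * ln n) + 1 / \<mu> * \<bar>ln (1 - p)\<bar>)"
  proof -
    \<comment> \<open>The common unit for all terms. The burn-in costs at most \<open>8 * Q\<close>,
      namely 4 for \<open>ln (card E)\<close> and 4 for \<open>- ln p\<close>, besides the term in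
      \<open>1 - p\<close>. The decay costs \<open>25 * k * Q\<close>, so 33 in all, within
      40.\<close>
    define Q where "Q = T * ln n / p"
    have lnQ: "ln n \<le> 2 * Q"
    proof -
      have "p * ln n \<le> (2 * T) * ln n" using T p lnn by (intro mult_right_mono) auto
      then show ?thesis using p by (simp add: Q_def field_simps)
    qed
    have "- ln p \<le> 1 / p"
      using ln_le_minus_one[of "1 / p"] p by (simp add: ln_div)
    also have "1 / p \<le> 4 * Q"
    proof -
      have "1 / 2 * (1 / 2) \<le> T * ln n" using T lnn by (intro mult_mono) auto
      then show ?thesis using p by (simp add: Q_def field_simps)
    qed
    finally have "\<mu> * t0 \<le> 8 * Q + \<bar>ln (1 - p)\<bar>" using lnE lnQ lnp \<mu> by (simp add: t0_def)
    moreover have "\<mu> * s = 25 * real k * Q" using \<mu> p T by (simp add: s_def \<gamma>_def Q_def field_simps)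
    moreover have "8 * Q + \<bar>ln (1 - p)\<bar> \<le> real k * (8 * Q + \<bar>ln (1 - p)\<bar>)"
      using mult_right_mono[OF k, of "8 * Q + \<bar>ln (1 - p)\<bar>"] lnQ lnn by simp
    moreover have "real k * (8 * Q + \<bar>ln (1 - p)\<bar>) + 25 * real k * Q \<le> 40 * real k * (Q + \<bar>ln (1 - p)\<bar>)"
    proof -
      have "0 \<le> real k * Q" "0 \<le> real k * \<bar>ln (1 - p)\<bar>" using lnQ lnn by auto
      then show ?thesis by (simp add: algebra_simps)
    qed
    ultimately have "\<mu> * t0 + \<mu> * s \<le> 40 * real k * (Q + \<bar>ln (1 - p)\<bar>)" by linarith
    then have "\<mu> * (t0 + s) \<le> 40 * real k * (Q + \<bar>ln (1 - p)\<bar>)" by (simp only: distrib_left)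
    then have "t0 + s \<le> 40 * real k * (Q + \<bar>ln (1 - p)\<bar>) / \<mu>" using \<mu> by (simp add: field_simps)
    also have "\<dots> = 40 * real k * (1 / (\<mu> * p) * (T * ln n) + 1 / \<mu> * \<bar>ln (1 - p)\<bar>)"
      using \<mu> p by (simp add: Q_def field_simps)
    finally show ?thesis .
  qed
  finally show ?thesis by (simp add: n_def T_def)
qed

end

text \<open>Vertices in the natural numbers lose no generality for finite graphs. The last
  inequality asks for three vertices: on a single edge \<open>D\<close> is only the logarithmic
  term, and the ratio of \<open>A\<close> to \<open>D\<close> is unbounded as \<open>p\<close> tends
  to 0.\<close>

theorem corollary1p4:
  "\<exists>C::real. C \<ge> 1 \<and>
     (\<forall>(V :: nat set) (E :: nat set set) (\<mu> :: real) (p :: real) (k :: nat).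
        simple_graph V E \<longrightarrow> connected_graph V E \<longrightarrow> card V \<ge> 2 \<longrightarrow>
        \<mu> \<in> {0<..1} \<longrightarrow> p \<in> {0<..1} \<longrightarrow> k \<ge> 1 \<longrightarrow>
        (let A = ereal (1 / (\<mu> * p)) * ereal (srw_rel_time V E * ln (real (card V)))
                   + ereal (1 / \<mu>) * abs_log_compl p;
             D = ereal (1 / (\<mu> * p)) * srw_tv_mixing_time V E (1 / real (card V))
                   + ereal (1 / \<mu>) * abs_log_compl p
         in ereal (1 / real k) * full_Linf_mixing_time V E \<mu> p (1 / real (card V) ^ k)
              \<le> ereal C * A
            \<and> ereal (1 / C) * D \<le> A
            \<and> (card V \<ge> 3 \<longrightarrow> A \<le> ereal C * D)))"
\<comment> \<open>The 40 comes from the mixing bound of the full process; comparing relaxation and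
  mixing time of the static walk costs only a factor 3.\<close>
proof (intro exI[of _ 40] conjI allI impI)
  fix V :: "nat set" and E :: "nat set set" and \<mu> p :: real and k :: nat
  assume G: "simple_graph V E" "connected_graph V E" "2 \<le> card V"
    and par: "\<mu> \<in> {0<..1}" "p \<in> {0<..1}" and k: "1 \<le> k"
  interpret connected_simple_graph V E by unfold_locales (fact G)+
  define r where "r = srw_rel_time V E * ln (real (card V))"
  have mix: "0 \<le> srw_tv_mixing_time V E (1 / real (card V))"
    "srw_tv_mixing_time V E (1 / real (card V)) \<le> ereal (3 * r)"
    using srw_tv_mixing_time_nonneg srw_tv_mixing_time_upper unfolding r_def by blast+
  \<comment> \<open>The upper bound makes the mixing time finite, so the comparison can take place
    in the reals.\<close>
  then obtain m where m: "srw_tv_mixing_time V E (1 / real (card V)) = ereal m"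
    by (cases "srw_tv_mixing_time V E (1 / real (card V))") auto
  have m_bounds: "0 \<le> m" "m \<le> 3 * r" "3 \<le> card V \<Longrightarrow> r / 3 \<le> m"
    using mix srw_tv_mixing_time_lower unfolding m r_def by auto
  show "let A = ereal (1 / (\<mu> * p)) * ereal (srw_rel_time V E * ln (real (card V)))
                   + ereal (1 / \<mu>) * abs_log_compl p;
             D = ereal (1 / (\<mu> * p)) * srw_tv_mixing_time V E (1 / real (card V))
                   + ereal (1 / \<mu>) * abs_log_compl p
         in ereal (1 / real k) * full_Linf_mixing_time V E \<mu> p (1 / real (card V) ^ k)
              \<le> ereal 40 * A
            \<and> ereal (1 / 40) * D \<le> A
            \<and> (card V \<ge> 3 \<longrightarrow> A \<le> ereal 40 * D)"
  \<comment> \<open>At \<open>p = 1\<close> both \<open>A\<close> and \<open>D\<close> are infinite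
    and all the inequalities are trivial.\<close>
  proof (cases "p = 1")
    case True
    then show ?thesis using par by (simp add: Let_def abs_log_compl_def m)
  next
    case False
    interpret dynamical_percolation V E \<mu> p by unfold_locales (use par False in auto)
    define l where "l = \<bar>ln (1 - p)\<bar>"
    have l: "abs_log_compl p = ereal l" "0 \<le> l" using False by (auto simp: abs_log_compl_def l_def)
    have c: "0 < 1 / (\<mu> * p)" "0 \<le> 1 / \<mu> * l" using \<mu> p l by auto
    have "ereal (1 / real k) * full_Linf_mixing_time V E \<mu> p (1 / real (card V) ^ k)
        \<le> ereal (1 / real k) * ereal (40 * real k * (1 / (\<mu> * p) * r + 1 / \<mu> * l))"
      using full_Linf_mixing_time_le[OF k] unfolding r_def l_def by (intro ereal_mult_left_mono) auto
    also have "\<dots> = ereal (40 * (1 / (\<mu> * p) * r + 1 / \<mu> * l))" using k by simp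
    finally have 1: "ereal (1 / real k) * full_Linf_mixing_time V E \<mu> p (1 / real (card V) ^ k)
        \<le> ereal (40 * (1 / (\<mu> * p) * r + 1 / \<mu> * l))" .
    have "1 / (\<mu> * p) * m \<le> 1 / (\<mu> * p) * (3 * r)" "0 \<le> 1 / (\<mu> * p) * m"
      using c m_bounds by (auto intro!: mult_left_mono simp del: times_divide_eq_left)
    then have 2: "1 / 40 * (1 / (\<mu> * p) * m + 1 / \<mu> * l) \<le> 1 / (\<mu> * p) * r + 1 / \<mu> * l"
      using c(2) by simp
    have 3: "1 / (\<mu> * p) * r + 1 / \<mu> * l \<le> 40 * (1 / (\<mu> * p) * m + 1 / \<mu> * l)" if "3 \<le> card V"
    proof -
      have "1 / (\<mu> * p) * r \<le> 1 / (\<mu> * p) * (40 * m)"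
        using c(1) m_bounds(1) m_bounds(3)[OF that] by (intro mult_left_mono) auto
      then show ?thesis using c(2) by simp
    qed
    show ?thesis
      unfolding Let_def l(1) m r_def[symmetric] times_ereal.simps(1) plus_ereal.simps(1) ereal_less_eq(3)
      using 1 2 3 by (intro conjI impI)
  qed
qed simp

end
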